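(* Let $p\neq 0$ and let $F:(t_1,t_2)\times(s_1,s_2)\to\mathrm{Sol}(3)$ be an orthogonal ruled surface. Then, in the global coordinates $(x,y,z)$, $F$ must have one of the following two forms. (1) $F(t,s)=(x(t,s),y(t,s),z(t,s))$ with $$x=A_1(t)-\frac1p\log\left(\cosh\left(\frac{p}{\varepsilon}s+c_1\right)\right),$$ $$y=\int_{t_0}^{t}e^{pA_1}\left(-\frac{\varepsilon}{p\alpha}c_1'\cos(A_1+\theta)+\frac{b_1}{\alpha}\sin(A_1+\theta)\right)dt+\frac{\varepsilon}{p\alpha}e^{pA_1}\cos(A_1+\theta)\tanh\left(\frac{p}{\varepsilon}s+c_1\right),$$ $$z=-\int_{t_0}^{t}e^{pA_1}\left(\frac{\varepsilon}{p\alpha}c_1'\sin(A_1+\theta)+\frac{b_1}{\alpha}\cos(A_1+\theta)\right)dt+\frac{\varepsilon}{p\alpha}e^{pA_1}\sin(A_1+\theta)\tanh\left(\frac{p}{\varepsilon}s+c_1\right),$$ where $c_1(t),\theta(t),A_1(t),b_1(t)$ are arbitrary smooth functions (primes denote $d/dt$, and $t_0\in(t_1,t_2)$ is the base point of integration). (2) $$F(t,s)=\left(R+\frac{s}{\varepsilon},\ A_2(t),\ A_3(t)\right),$$ where $R\in\mathbb{R}$ and $A_2(t),A_3(t)$ are arbitrary smooth functions.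
   Context: Fix $p\in\mathbb{R}$ and $\varepsilon,\alpha>0$. $\mathrm{Sol}(3)$ denotes the Lie group $\mathbb{R}^3$, with global coordinates $(x,y,z)$ and product $(x,y,z)\cdot(x',y',z')=(x+x',\ \exp(Ax)(y',z')+(y,z))$, where $A=\begin{pmatrix}p&-1\\1&p\end{pmatrix}$. Its left-invariant frame $e_1,e_2,e_3$ (equal to the standard basis at the identity) satisfies $[e_1,e_2]=pe_2+e_3$, $[e_1,e_3]=-e_2+pe_3$, $[e_2,e_3]=0$. With dual coframe $\lambda^1,\lambda^2,\lambda^3$, the group carries the left-invariant metric $g=\varepsilon^2(\lambda^1)^2+\alpha^2((\lambda^2)^2+(\lambda^3)^2)$. The frame $u_1=\frac1\varepsilon e_1$, $u_2=\frac1\alpha e_2$, $u_3=\frac1\alpha e_3$ is orthonormal; in the global coordinates, $u_1=\frac1\varepsilon\partial_x$, $u_2=\frac{1}{\alpha}e^{px}(\cos x\,\partial_y+\sin x\,\partial_z)$, $u_3=\frac1\alpha e^{px}(-\sin x\,\partial_y+\cos x\,\partial_z)$. A ruled surface is a smooth map $F(t,s)=\exp_{\gamma(t)}(sX(t))$ on $(t_1,t_2)\times(s_1,s_2)$, where $\gamma$ is a smooth curve, $X$ is a nowhere vanishing smooth vector field along $\gamma$, and $\exp$ is the Riemannian exponential map; thus $\nabla_{F_s}F_s=0$, with $F_s=dF(\partial_s)$, $F_t=dF(\partial_t)$ and $\nabla$ the Levi-Civita connection. It is orthogonal if $g(F_t,F_s)=0$ everywhere; then $\|F_s\|_g$ is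 constant.
   Formalization: Constants of integration are added to y and z; s is replaced by s/k, where |k| is the constant norm of F_s; the forms hold on each open t-interval avoiding the frontier of the set of t whose ruling is tangent to e_1 (all of (t_1,t_2) if rulings are of one type). *)

theory Defs
  imports "HOL-Analysis.Analysis"
begin

section \<open>Smooth maps on open sets\<close>

primrec Ck_on :: "nat \<Rightarrow> 'a::real_normed_vector set \<Rightarrow> ('a \<Rightarrow> 'b::real_normed_vector) \<Rightarrow> bool" where
  "Ck_on 0 U f \<longleftrightarrow> continuous_on U f"
| "Ck_on (Suc k) U f \<longleftrightarrow> (\<forall>x\<in>U. f differentiable (at x)) \<and>
     (\<forall>v. Ck_on k U (\<lambda>x. frechet_derivative f (at x) v))"

text \<open>Meant for open \<open>U\<close> only, since it uses two-sided derivatives.\<close>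
definition smooth_on :: "'a::real_normed_vector set \<Rightarrow> ('a \<Rightarrow> 'b::real_normed_vector) \<Rightarrow> bool" where
  "smooth_on U f \<longleftrightarrow> (\<forall>k. Ck_on k U f)"


section \<open>Riemannian metrics on \<open>\<real>\<^sup>n\<close> in a global chart\<close>

text \<open>\<open>g q v w\<close> is the inner product of the tangent vectors \<open>v\<close> and \<open>w\<close> at the point \<open>q\<close>, all
  expressed in the global coordinates.\<close>
type_synonym 'n metric_tensor = "real^'n \<Rightarrow> real^'n \<Rightarrow> real^'n \<Rightarrow> real"

definition gram :: "'n::finite metric_tensor \<Rightarrow> real^'n \<Rightarrow> real^'n^'n" where
  "gram g q = (\<chi> i j. g q (axis i 1) (axis j 1))"

definition dgram :: "'n::finite metric_tensor \<Rightarrow> 'n \<Rightarrow> 'n \<Rightarrow> 'n \<Rightarrow> real^'n \<Rightarrow> real" where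
  "dgram g l i j q = frechet_derivative (\<lambda>r. gram g r $ i $ j) (at q) (axis l 1)"

text \<open>The coefficients of the Levi-Civita connection:
  \<open>\<nabla>\<^bsub>\<partial>i\<^esub> \<partial>j = (\<Sum>k. christoffel g q k i j \<partial>k)\<close>.\<close>
definition christoffel :: "'n::finite metric_tensor \<Rightarrow> real^'n \<Rightarrow> 'n \<Rightarrow> 'n \<Rightarrow> 'n \<Rightarrow> real" where
  "christoffel g q k i j =
     (\<Sum>l\<in>UNIV. matrix_inv (gram g q) $ k $ l *
        (dgram g i j l q + dgram g j i l q - dgram g l i j q)) / 2"

text \<open>\<open>v\<close> and \<open>a\<close> are the first and second coordinate derivatives of \<open>c\<close>; the last conjunct is
  \<open>\<nabla>\<^bsub>c'\<^esub> c' = 0\<close>.\<close>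
definition geodesic_on :: "'n::finite metric_tensor \<Rightarrow> real set \<Rightarrow> (real \<Rightarrow> real^'n) \<Rightarrow> bool" where
  "geodesic_on g I c \<longleftrightarrow> (\<exists>v a. \<forall>\<tau>\<in>I.
     (c has_vector_derivative v \<tau>) (at \<tau> within I) \<and>
     (v has_vector_derivative a \<tau>) (at \<tau> within I) \<and>
     (\<forall>k. a \<tau> $ k + (\<Sum>i\<in>UNIV. \<Sum>j\<in>UNIV. christoffel g (c \<tau>) k i j * v \<tau> $ i * v \<tau> $ j) = 0))"

definition riem_exp :: "'n::finite metric_tensor \<Rightarrow> real^'n \<Rightarrow> real^'n \<Rightarrow> real^'n" where
  "riem_exp g q v = (THE r. \<exists>c. geodesic_on g {0..1} c \<and> c 0 = q \<and>
     (c has_vector_derivative v) (at 0 within {0..1}) \<and> c 1 = r)"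


section \<open>Orthogonal ruled surfaces\<close>

definition surf_t :: "(real \<times> real \<Rightarrow> real^'n) \<Rightarrow> real \<times> real \<Rightarrow> real^'n" where
  "surf_t F = (\<lambda>(t, s). vector_derivative (\<lambda>t. F (t, s)) (at t))"

definition surf_s :: "(real \<times> real \<Rightarrow> real^'n) \<Rightarrow> real \<times> real \<Rightarrow> real^'n" where
  "surf_s F = (\<lambda>(t, s). vector_derivative (\<lambda>s. F (t, s)) (at s))"

definition ruled_surface ::
    "'n::finite metric_tensor \<Rightarrow> real set \<Rightarrow> real set \<Rightarrow> (real \<times> real \<Rightarrow> real^'n) \<Rightarrow> bool" where
  "ruled_surface g T S F \<longleftrightarrow> smooth_on (T \<times> S) F \<and>
     (\<exists>\<gamma> X. smooth_on T \<gamma> \<and> smooth_on T X \<and> (\<forall>t\<in>T. X t \<noteq> 0) \<and>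
        (\<forall>t\<in>T. \<forall>s\<in>S. F (t, s) = riem_exp g (\<gamma> t) (s *\<^sub>R X t)))"

definition orthogonal_ruled_surface ::
    "'n::finite metric_tensor \<Rightarrow> real set \<Rightarrow> real set \<Rightarrow> (real \<times> real \<Rightarrow> real^'n) \<Rightarrow> bool" where
  "orthogonal_ruled_surface g T S F \<longleftrightarrow> ruled_surface g T S F \<and>
     (\<forall>t\<in>T. \<forall>s\<in>S. g (F (t, s)) (surf_t F (t, s)) (surf_s F (t, s)) = 0)"


section \<open>The group \<open>Sol(3)\<close> and its left-invariant metric\<close>

text \<open>The powers are iterated matrix products; \<open>^\<close> on \<open>real^'n^'n\<close> would be componentwise.\<close>
definition mat_exp :: "real^'n^'n \<Rightarrow> real^'n^'n" where
  "mat_exp M = (\<Sum>k. (1 / fact k) *\<^sub>R (((**) M) ^^ k) (mat 1))"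

definition sol_matrix :: "real \<Rightarrow> real^2^2" where
  "sol_matrix p = vector [vector [p, -1], vector [1, p]]"

definition sol_mult :: "real \<Rightarrow> real^3 \<Rightarrow> real^3 \<Rightarrow> real^3" where
  "sol_mult p q r =
     (let w = mat_exp (q $ 1 *\<^sub>R sol_matrix p) *v vector [r $ 2, r $ 3] + vector [q $ 2, q $ 3]
      in vector [q $ 1 + r $ 1, w $ 1, w $ 2])"

text \<open>The frame \<open>e\<^sub>1, e\<^sub>2, e\<^sub>3\<close> at \<open>q\<close>: the image of the standard basis at the identity \<open>0\<close> under
  the differential of left translation by \<open>q\<close>.\<close>
definition sol_frame :: "real \<Rightarrow> 3 \<Rightarrow> real^3 \<Rightarrow> real^3" where
  "sol_frame p i q = frechet_derivative (sol_mult p q) (at 0) (axis i 1)"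

definition sol_coframe :: "real \<Rightarrow> real^3 \<Rightarrow> real^3 \<Rightarrow> real^3" where
  "sol_coframe p q v = (THE l. v = (\<Sum>i\<in>UNIV. l $ i *\<^sub>R sol_frame p i q))"

definition sol_metric :: "real \<Rightarrow> real \<Rightarrow> real \<Rightarrow> 3 metric_tensor" where
  "sol_metric p \<epsilon> \<alpha> q v w =
     (let l = sol_coframe p q v; m = sol_coframe p q w
      in \<epsilon>\<^sup>2 * (l $ 1 * m $ 1) + \<alpha>\<^sup>2 * (l $ 2 * m $ 2 + l $ 3 * m $ 3))"

definition sol_norm :: "real \<Rightarrow> real \<Rightarrow> real \<Rightarrow> real^3 \<Rightarrow> real^3 \<Rightarrow> real" where
  "sol_norm p \<epsilon> \<alpha> q v = sqrt (sol_metric p \<epsilon> \<alpha> q v v)"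


section \<open>The two normal forms\<close>

text \<open>The parameters \<open>t\<close>, \<open>s\<close> range over \<open>T\<close>, \<open>S\<close>. The constants \<open>y0\<close>, \<open>z0\<close> are the constants of
  integration: left translation by \<open>(0, y0, z0)\<close> is an isometry that adds them to \<open>y\<close> and \<open>z\<close>.
  \<open>LBINT\<close> is oriented, so \<open>t < t0\<close> is allowed.\<close>
definition sol_form1 ::
    "real \<Rightarrow> real \<Rightarrow> real \<Rightarrow> real set \<Rightarrow> real set \<Rightarrow> (real \<times> real \<Rightarrow> real^3) \<Rightarrow> bool" where
  "sol_form1 p \<epsilon> \<alpha> T S F \<longleftrightarrow>
     (\<exists>c1 \<theta> A1 b1. \<exists>t0\<in>T. \<exists>y0 z0.
        smooth_on T c1 \<and> smooth_on T \<theta> \<and> smooth_on T A1 \<and> smooth_on T b1 \<and>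
        (\<forall>t\<in>T. \<forall>s\<in>S. F (t, s) = vector
          [A1 t - 1 / p * ln (cosh (p / \<epsilon> * s + c1 t)),
           y0 + (LBINT u=t0..t. exp (p * A1 u) *
                   (- (\<epsilon> / (p * \<alpha>)) * deriv c1 u * cos (A1 u + \<theta> u)
                    + b1 u / \<alpha> * sin (A1 u + \<theta> u)))
              + \<epsilon> / (p * \<alpha>) * exp (p * A1 t) * cos (A1 t + \<theta> t) * tanh (p / \<epsilon> * s + c1 t),
           z0 - (LBINT u=t0..t. exp (p * A1 u) *
                   (\<epsilon> / (p * \<alpha>) * deriv c1 u * sin (A1 u + \<theta> u)
                    + b1 u / \<alpha> * cos (A1 u + \<theta> u)))
              + \<epsilon> / (p * \<alpha>) * exp (p * A1 t) * sin (A1 t + \<theta> t) * tanh (p / \<epsilon> * s + c1 t)]))"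

definition sol_form2 ::
    "real \<Rightarrow> real set \<Rightarrow> real set \<Rightarrow> (real \<times> real \<Rightarrow> real^3) \<Rightarrow> bool" where
  "sol_form2 \<epsilon> T S F \<longleftrightarrow>
     (\<exists>R A2 A3. smooth_on T A2 \<and> smooth_on T A3 \<and>
        (\<forall>t\<in>T. \<forall>s\<in>S. F (t, s) = vector [R + s / \<epsilon>, A2 t, A3 t]))"

text \<open>The parameters \<open>t\<close> whose ruling \<open>s \<mapsto> F (t, s)\<close> is tangent to \<open>e\<^sub>1\<close>. The rulings of form (1)
  are nowhere tangent to \<open>e\<^sub>1\<close>, those of form (2) everywhere. Both kinds may occur on one
  surface, for example when \<open>\<gamma> t = (0, t, 0)\<close> and \<open>X t = cos t u\<^sub>1 + sin t u\<^sub>3\<close>; the surface then has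
  one of the two forms only on intervals that avoid the frontier of this set. If all rulings are of
  the same kind, the frontier does not meet \<open>T\<close>.\<close>
definition vertical_rulings ::
    "real \<Rightarrow> real set \<Rightarrow> real set \<Rightarrow> (real \<times> real \<Rightarrow> real^3) \<Rightarrow> real set" where
  "vertical_rulings p T S F =
     {t \<in> T. \<forall>s\<in>S. surf_s F (t, s) \<in> span {sol_frame p 1 (F (t, s))}}"

end

theory Submission
  imports Defs
begin

text \<open>
  The metric is \<open>\<epsilon>\<^sup>2 dx\<^sup>2 + \<alpha>\<^sup>2 exp (-2px) (dy\<^sup>2 + dz\<^sup>2)\<close>. Along a geodesic \<open>exp (-2px) y'\<close>,
  \<open>exp (-2px) z'\<close> and the energy \<open>E\<close> are constant, so \<open>w = exp (-px)\<close> solves the linear equation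
  \<open>w'' = (p\<^sup>2 E / \<epsilon>\<^sup>2) w\<close>. Hence a geodesic that is not tangent to \<open>e\<^sub>1\<close> has the form
  \<open>(A - ln (cosh \<tau>) / p, Y + P tanh \<tau>, Z + Q tanh \<tau>)\<close> with \<open>\<tau> = L s + c\<close>,
  \<open>P\<^sup>2 + Q\<^sup>2 = (\<epsilon> / (p \<alpha>))\<^sup>2 exp (2pA)\<close> and \<open>L = p (sqrt E) / \<epsilon>\<close>. If these parameters depend on \<open>t\<close>, then
  \<open>g F\<^sub>t F\<^sub>s = L (\<epsilon>\<^sup>2 / p\<^sup>2 (L' s + c') + \<alpha>\<^sup>2 exp (-2pA) (P Y' + Q Z'))\<close>. Orthogonality therefore says that \<open>L\<close>
  is constant and that the component of \<open>(Y', Z')\<close> along \<open>(P, Q)\<close> is prescribed by \<open>c'\<close>. The other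
  component is the free function \<open>b\<^sub>1\<close>, and \<open>A + \<theta>\<close> is the angle of \<open>(P, Q)\<close>. Where the rulings are
  tangent to \<open>e\<^sub>1\<close> on an open set of parameters, orthogonality forces their initial height and speed
  to be constant. These two kinds of parameters are dense, so the speed is constant everywhere.
\<close>

section \<open>Calculus of smooth functions\<close>

lemma Ck_on_Suc_imp: "Ck_on (Suc k) U f \<Longrightarrow> Ck_on k U f"
proof (induction k arbitrary: f)
  case 0
  then show ?case
    by (auto intro!: continuous_at_imp_continuous_on differentiable_imp_continuous_within)
next
  case (Suc k)
  then show ?case
    unfolding Ck_on.simps(2)[of "Suc k"] Ck_on.simps(2)[of k U f] by blast
qed

lemma Ck_on_subset: "Ck_on k U f \<Longrightarrow> V \<subseteq> U \<Longrightarrow> Ck_on k V f"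
  by (induction k arbitrary: f) (auto intro: continuous_on_subset)

text \<open>Openness of \<open>U\<close> makes the derivative at a point depend only on values
  inside \<open>U\<close>. The derivatives of \<open>f\<close> and \<open>g\<close> therefore agree
  on \<open>U\<close>, and the induction continues with them.\<close>

lemma Ck_on_cong:
  assumes "open U" "Ck_on k U f" "\<And>x. x \<in> U \<Longrightarrow> f x = g x"
  shows "Ck_on k U g"
  using assms(2,3)
proof (induction k arbitrary: f g)
  case 0
  then show ?case using continuous_on_eq[of U f g] by simp
next
  case (Suc k)
  have d: "(g has_derivative frechet_derivative f (at x)) (at x)" if "x \<in> U" for x
  proof (rule has_derivative_transform_within_open[OF _ assms(1) that])
    show "(f has_derivative frechet_derivative f (at x)) (at x)"
      using Suc.prems(1) that by (simp add: frechet_derivative_works)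
  qed (use Suc.prems(2) in simp)
  have eq: "frechet_derivative g (at x) = frechet_derivative f (at x)" if "x \<in> U" for x
    using d[OF that] by (metis frechet_derivative_at)
  show ?case
    unfolding Ck_on.simps
  proof (intro conjI ballI allI)
    show "g differentiable at x" if "x \<in> U" for x
      using d[OF that] differentiable_def by blast
    show "Ck_on k U (\<lambda>x. frechet_derivative g (at x) v)" for v
    proof (rule Suc.IH)
      show "Ck_on k U (\<lambda>x. frechet_derivative f (at x) v)"
        using Suc.prems(1) by simp
    qed (simp add: eq)
  qed
qed

text \<open>Derivatives are unique, so any explicit \<open>f'\<close> may stand for
  \<open>frechet_derivative f\<close> when a class is established.\<close>

lemma Ck_on_SucI:
  assumes "open U" "\<And>x. x \<in> U \<Longrightarrow> (f has_derivative f' x) (at x)"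
    and "\<And>v. Ck_on k U (\<lambda>x. f' x v)"
  shows "Ck_on (Suc k) U f"
  unfolding Ck_on.simps
proof (intro conjI ballI allI)
  show "f differentiable at x" if "x \<in> U" for x
    using assms(2)[OF that] differentiable_def by blast
  show "Ck_on k U (\<lambda>x. frechet_derivative f (at x) v)" for v
    using assms(2) by (intro Ck_on_cong[OF assms(1) assms(3)[of v]]) (metis frechet_derivative_at)
qed

lemma Ck_on_SucD:
  assumes "Ck_on (Suc k) U f" "x \<in> U"
  shows "(f has_derivative frechet_derivative f (at x)) (at x)"
  using assms by (auto simp: frechet_derivative_works)

lemma Ck_on_const: "open U \<Longrightarrow> Ck_on k U (\<lambda>x. c)"
proof (induction k arbitrary: c)
  case (Suc k)
  then show ?case by (intro Ck_on_SucI[where f' = "\<lambda>x v. 0"]) auto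
qed auto

lemma Ck_on_linear:
  assumes "open U" "bounded_linear h"
  shows "Ck_on k U h"
proof (cases k)
  case 0
  then show ?thesis using assms by (simp add: linear_continuous_on)
next
  case (Suc j)
  show ?thesis
    unfolding Suc
    by (rule Ck_on_SucI[where f' = "\<lambda>x. h"])
      (auto simp: assms Ck_on_const bounded_linear_imp_has_derivative)
qed

lemma Ck_on_linear_compose:
  assumes "open U" "bounded_linear h" "Ck_on k U f"
  shows "Ck_on k U (\<lambda>x. h (f x))"
  using assms(3)
proof (induction k arbitrary: f)
  case 0
  then show ?case
    using assms by (auto intro: bounded_linear.continuous_on)
next
  case (Suc k)
  show ?case
    by (rule Ck_on_SucI[OF assms(1), where f' = "\<lambda>x v. h (frechet_derivative f (at x) v)"])
      (use Suc in \<open>auto intro!: bounded_linear.has_derivative[OF assms(2)] Ck_on_SucD\<close>)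
qed

text \<open>A bounded linear \<open>h\<close> is its own derivative. The chain rule therefore leaves
  \<open>frechet_derivative f\<close> at \<open>h x\<close> in the fixed direction
  \<open>h v\<close>, which again has the shape of the claim.\<close>

lemma Ck_on_compose_linear:
  assumes "open U" "bounded_linear h" "h ` U \<subseteq> W" "Ck_on k W f"
  shows "Ck_on k U (\<lambda>x. f (h x))"
  using assms(4)
proof (induction k arbitrary: f)
  case 0
  then show ?case
    using assms(3) linear_continuous_on[OF assms(2)] by (auto intro: continuous_on_compose2[of W f])
next
  case (Suc k)
  show ?case
  proof (rule Ck_on_SucI[OF assms(1), where f' = "\<lambda>x v. frechet_derivative f (at (h x)) (h v)"])
    show "((\<lambda>x. f (h x)) has_derivative (\<lambda>v. frechet_derivative f (at (h x)) (h v))) (at x)" if "x \<in> U" for x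
      using that Suc.prems assms
      by (intro has_derivative_compose[OF bounded_linear_imp_has_derivative[OF assms(2)] Ck_on_SucD]) auto
    show "Ck_on k U (\<lambda>x. frechet_derivative f (at (h x)) (h v))" for v
      using Suc.prems by (intro Suc.IH[of "\<lambda>y. frechet_derivative f (at y) (h v)"]) auto
  qed
qed

lemma Ck_on_add:
  assumes "open U" "Ck_on k U f" "Ck_on k U g"
  shows "Ck_on k U (\<lambda>x. f x + g x)"
  using assms(2,3)
proof (induction k arbitrary: f g)
  case 0
  then show ?case by (auto intro: continuous_intros)
next
  case (Suc k)
  show ?case
    by (rule Ck_on_SucI[OF assms(1), where
          f' = "\<lambda>x v. frechet_derivative f (at x) v + frechet_derivative g (at x) v"])
      (use Suc in \<open>auto intro!: has_derivative_add Ck_on_SucD\<close>)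
qed

lemma Ck_on_mult:
  fixes f g :: "'a::real_normed_vector \<Rightarrow> real"
  assumes "open U" "Ck_on k U f" "Ck_on k U g"
  shows "Ck_on k U (\<lambda>x. f x * g x)"
  using assms(2,3)
proof (induction k arbitrary: f g)
  case 0
  then show ?case by (auto intro: continuous_intros)
next
  case (Suc k)
  \<comment> \<open>The product rule keeps one factor undifferentiated, and that factor enters the
    induction hypothesis at the lower order \<open>k\<close>.\<close>
  note k = Suc.prems[THEN Ck_on_Suc_imp]
  show ?case
  proof (rule Ck_on_SucI[OF assms(1), where
        f' = "\<lambda>x v. f x * frechet_derivative g (at x) v + frechet_derivative f (at x) v * g x"])
    show "((\<lambda>x. f x * g x) has_derivative
        (\<lambda>v. f x * frechet_derivative g (at x) v + frechet_derivative f (at x) v * g x)) (at x)"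
      if "x \<in> U" for x
      using that Suc.prems by (intro has_derivative_mult Ck_on_SucD)
    show "Ck_on k U (\<lambda>x. f x * frechet_derivative g (at x) v + frechet_derivative f (at x) v * g x)" for v
      using Suc.prems by (intro Ck_on_add assms(1) Suc.IH k) auto
  qed
qed

lemma frechet_derivative_real:
  fixes f :: "real \<Rightarrow> real"
  assumes "f differentiable at x"
  shows "frechet_derivative f (at x) v = deriv f x * v"
  using assms DERIV_deriv_iff_real_differentiable frechet_derivative_at has_field_derivative_def by metis

text \<open>On the line every directional derivative is a multiple of \<open>deriv f\<close>, so
  \<open>Ck_on\<close> can be unfolded with \<open>deriv\<close> alone.\<close>

lemma Ck_on_Suc_real:
  fixes f :: "real \<Rightarrow> real"
  assumes "open U"
  shows "Ck_on (Suc k) U f \<longleftrightarrow> (\<forall>x\<in>U. f differentiable at x) \<and> Ck_on k U (deriv f)"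
proof (intro iffI conjI)
  assume *: "Ck_on (Suc k) U f"
  then show "\<forall>x\<in>U. f differentiable at x" by simp
  from * have "Ck_on k U (\<lambda>x. frechet_derivative f (at x) 1)" by simp
  from Ck_on_cong[OF assms this] show "Ck_on k U (deriv f)"
    using * by (simp add: frechet_derivative_real)
next
  assume *: "(\<forall>x\<in>U. f differentiable at x) \<and> Ck_on k U (deriv f)"
  show "Ck_on (Suc k) U f"
  proof (rule Ck_on_SucI[OF assms, where f' = "\<lambda>x v. deriv f x * v"])
    show "(f has_derivative (*) (deriv f x)) (at x)" if "x \<in> U" for x
      using * that DERIV_deriv_iff_real_differentiable has_field_derivative_def by blast
    show "Ck_on k U (\<lambda>x. deriv f x * v)" for v
      using * assms by (intro Ck_on_mult Ck_on_const) auto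
  qed
qed

lemma Ck_on_real_SucI:
  fixes f :: "real \<Rightarrow> real"
  assumes "open U" "\<And>x. x \<in> U \<Longrightarrow> (f has_real_derivative f' x) (at x)" "Ck_on k U f'"
  shows "Ck_on (Suc k) U f"
proof (subst Ck_on_Suc_real[OF assms(1)], intro conjI ballI)
  show "f differentiable at x" if "x \<in> U" for x
    using assms(2)[OF that] real_differentiable_def by blast
  show "Ck_on k U (deriv f)"
    by (rule Ck_on_cong[OF assms(1,3)]) (metis DERIV_imp_deriv assms(2))
qed

text \<open>The induction varies the outer function and keeps \<open>f\<close> fixed: the chain rule
  produces \<open>deriv h\<close> composed with \<open>f\<close>, times a directional derivative of
  \<open>f\<close>, and \<open>Ck_on_mult\<close> combines the two.\<close>

lemma Ck_on_compose_real:
  fixes f :: "'a::real_normed_vector \<Rightarrow> real" and h :: "real \<Rightarrow> real"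
  assumes "open U" "open W" "f ` U \<subseteq> W" "Ck_on k W h" "Ck_on k U f"
  shows "Ck_on k U (\<lambda>x. h (f x))"
  using assms(4,5)
proof (induction k arbitrary: h)
  case 0
  then show ?case
    using assms(3) by (auto intro!: continuous_on_compose2[of W h])
next
  case (Suc k)
  have h: "h differentiable at y" if "y \<in> W" for y
    using Suc.prems that by simp
  show ?case
  proof (rule Ck_on_SucI[OF assms(1), where
        f' = "\<lambda>x v. deriv h (f x) * frechet_derivative f (at x) v"])
    show "((\<lambda>x. h (f x)) has_derivative (\<lambda>v. deriv h (f x) * frechet_derivative f (at x) v)) (at x)"
      if "x \<in> U" for x
    proof (rule has_derivative_compose[OF Ck_on_SucD[OF Suc.prems(2) that], of h "(*) (deriv h (f x))"])
      have "f x \<in> W" using assms(3) that by auto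
      then show "(h has_derivative (*) (deriv h (f x))) (at (f x))"
        using h DERIV_deriv_iff_real_differentiable has_field_derivative_def by blast
    qed
    show "Ck_on k U (\<lambda>x. deriv h (f x) * frechet_derivative f (at x) v)" for v
    proof (rule Ck_on_mult[OF assms(1)])
      have "Ck_on k W (deriv h)"
        using Suc.prems(1) Ck_on_Suc_real[OF assms(2)] by blast
      then show "Ck_on k U (\<lambda>x. deriv h (f x))"
        by (rule Suc.IH[OF _ Ck_on_Suc_imp[OF Suc.prems(2)]])
      show "Ck_on k U (\<lambda>x. frechet_derivative f (at x) v)"
        using Suc.prems(2) by simp
    qed
  qed
qed

section \<open>Rules for smooth functions\<close>

lemma smooth_on_subset: "smooth_on U f \<Longrightarrow> V \<subseteq> U \<Longrightarrow> smooth_on V f"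
  unfolding smooth_on_def using Ck_on_subset by blast

lemma smooth_on_cong:
  "open U \<Longrightarrow> smooth_on U f \<Longrightarrow> (\<And>x. x \<in> U \<Longrightarrow> f x = g x) \<Longrightarrow> smooth_on U g"
  unfolding smooth_on_def using Ck_on_cong by blast

lemma smooth_on_const: "open U \<Longrightarrow> smooth_on U (\<lambda>x. c)"
  by (simp add: smooth_on_def Ck_on_const)

lemma smooth_on_linear: "open U \<Longrightarrow> bounded_linear h \<Longrightarrow> smooth_on U h"
  by (simp add: smooth_on_def Ck_on_linear)

lemma smooth_on_linear_compose:
  "open U \<Longrightarrow> bounded_linear h \<Longrightarrow> smooth_on U f \<Longrightarrow> smooth_on U (\<lambda>x. h (f x))"
  by (simp add: smooth_on_def Ck_on_linear_compose)

lemma smooth_on_compose_fst: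
  "open U \<Longrightarrow> open W \<Longrightarrow> smooth_on U f \<Longrightarrow> smooth_on (U \<times> W) (\<lambda>x. f (fst x))"
  by (auto simp: smooth_on_def open_Times intro!: Ck_on_compose_linear[of _ fst U] bounded_linear_fst)

lemma smooth_on_add:
  "open U \<Longrightarrow> smooth_on U f \<Longrightarrow> smooth_on U g \<Longrightarrow> smooth_on U (\<lambda>x. f x + g x)"
  by (simp add: smooth_on_def Ck_on_add)

lemma smooth_on_minus: "open U \<Longrightarrow> smooth_on U f \<Longrightarrow> smooth_on U (\<lambda>x. - f x)"
  by (rule smooth_on_linear_compose[OF _ bounded_linear_minus[OF bounded_linear_ident]])

lemma smooth_on_diff:
  "open U \<Longrightarrow> smooth_on U f \<Longrightarrow> smooth_on U g \<Longrightarrow> smooth_on U (\<lambda>x. f x - g x)"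
  using smooth_on_add[OF _ _ smooth_on_minus, of U f g] by simp

lemma smooth_on_mult:
  fixes f g :: "'a::real_normed_vector \<Rightarrow> real"
  shows "open U \<Longrightarrow> smooth_on U f \<Longrightarrow> smooth_on U g \<Longrightarrow> smooth_on U (\<lambda>x. f x * g x)"
  by (simp add: smooth_on_def Ck_on_mult)

lemma smooth_on_power:
  fixes f :: "'a::real_normed_vector \<Rightarrow> real"
  shows "open U \<Longrightarrow> smooth_on U f \<Longrightarrow> smooth_on U (\<lambda>x. f x ^ n)"
  by (induction n) (auto intro: smooth_on_const smooth_on_mult)

lemma smooth_on_compose_real:
  fixes f :: "'a::real_normed_vector \<Rightarrow> real" and h :: "real \<Rightarrow> real"
  assumes "smooth_on W h" "open W" "open U" "\<And>x. x \<in> U \<Longrightarrow> f x \<in> W" "smooth_on U f"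
  shows "smooth_on U (\<lambda>x. h (f x))"
  unfolding smooth_on_def
proof
  show "Ck_on k U (\<lambda>x. h (f x))" for k
    by (rule Ck_on_compose_real[of U W]) (use assms in \<open>auto simp: smooth_on_def\<close>)
qed

lemma smooth_on_real_deriv:
  fixes f :: "real \<Rightarrow> real"
  assumes "open U" "smooth_on U f"
  shows "smooth_on U (deriv f)"
  using assms Ck_on_Suc_real by (metis smooth_on_def)

lemma smooth_on_DERIV:
  fixes f :: "real \<Rightarrow> real"
  assumes "smooth_on U f" "x \<in> U"
  shows "(f has_real_derivative deriv f x) (at x)"
  using assms DERIV_deriv_iff_real_differentiable by (metis smooth_on_def Ck_on.simps(2))

lemma smooth_on_imp_continuous_on: "smooth_on U f \<Longrightarrow> continuous_on U f"
  by (metis smooth_on_def Ck_on.simps(1))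

text \<open>\<open>f\<close> is one class better than \<open>f'\<close>. This gives smoothness of
  functions known through their derivative: the logarithm, integrals with a variable endpoint, angle
  functions.\<close>

lemma smooth_on_antiderivative:
  fixes f :: "real \<Rightarrow> real"
  assumes "open U" "\<And>x. x \<in> U \<Longrightarrow> (f has_real_derivative f' x) (at x)" "smooth_on U f'"
  shows "smooth_on U f"
  unfolding smooth_on_def
proof
  show "Ck_on k U f" for k
    using assms Ck_on_real_SucI Ck_on_Suc_imp by (metis smooth_on_def)
qed

section \<open>Smoothness of elementary functions\<close>

lemma smooth_on_exp_real: "smooth_on UNIV (exp :: real \<Rightarrow> real)"
  unfolding smooth_on_def
proof
  show "Ck_on k UNIV (exp :: real \<Rightarrow> real)" for k
  proof (induction k)
    case (Suc k)
    then show ?case by (rule Ck_on_real_SucI[OF open_UNIV DERIV_exp])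
  qed (auto intro: continuous_intros)
qed

text \<open>Each function is, up to sign, the derivative of the other, so one induction treats
  both.\<close>

lemma smooth_on_sin_real: "smooth_on UNIV (sin :: real \<Rightarrow> real)"
  and smooth_on_cos_real: "smooth_on UNIV (cos :: real \<Rightarrow> real)"
proof -
  have "Ck_on k UNIV (sin :: real \<Rightarrow> real) \<and> Ck_on k UNIV (cos :: real \<Rightarrow> real)" for k
  proof (induction k)
    case 0
    then show ?case by (auto intro: continuous_intros)
  next
    case (Suc k)
    have "Ck_on k UNIV (\<lambda>x::real. - sin x)"
      using Ck_on_linear_compose[OF open_UNIV bounded_linear_minus[OF bounded_linear_ident]] Suc by blast
    then show ?case
      using Suc Ck_on_real_SucI[OF open_UNIV DERIV_sin] Ck_on_real_SucI[OF open_UNIV DERIV_cos] by blast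
  qed
  then show "smooth_on UNIV (sin :: real \<Rightarrow> real)" "smooth_on UNIV (cos :: real \<Rightarrow> real)"
    by (auto simp: smooth_on_def)
qed

lemma smooth_on_inverse_real: "smooth_on (- {0}) (inverse :: real \<Rightarrow> real)"
  unfolding smooth_on_def
proof
  have o: "open (- {0::real})" by auto
  show "Ck_on k (- {0}) (inverse :: real \<Rightarrow> real)" for k
  proof (induction k)
    case 0
    then show ?case by (auto intro!: continuous_intros)
  next
    case (Suc k)
    have "Ck_on k (- {0}) (\<lambda>x::real. - (inverse x * inverse x))"
      using Ck_on_linear_compose[OF o bounded_linear_minus[OF bounded_linear_ident] Ck_on_mult[OF o Suc Suc]] .
    then show ?case
      by (rule Ck_on_real_SucI[OF o, rotated]) (auto intro!: derivative_eq_intros simp: power2_eq_square)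
  qed
qed

lemma smooth_on_ln_real: "smooth_on {0<..} (ln :: real \<Rightarrow> real)"
  by (rule smooth_on_antiderivative[OF _ _ smooth_on_subset[OF smooth_on_inverse_real]])
    (auto intro!: derivative_eq_intros simp: divide_inverse)

lemmas smooth_on_exp = smooth_on_compose_real[OF smooth_on_exp_real open_UNIV _ UNIV_I]
lemmas smooth_on_sin = smooth_on_compose_real[OF smooth_on_sin_real open_UNIV _ UNIV_I]
lemmas smooth_on_cos = smooth_on_compose_real[OF smooth_on_cos_real open_UNIV _ UNIV_I]

lemma smooth_on_inverse:
  fixes f :: "'a::real_normed_vector \<Rightarrow> real"
  assumes "open U" "smooth_on U f" "\<And>x. x \<in> U \<Longrightarrow> f x \<noteq> 0"
  shows "smooth_on U (\<lambda>x. inverse (f x))"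
  using assms by (intro smooth_on_compose_real[OF smooth_on_inverse_real]) auto

lemma smooth_on_divide:
  fixes f g :: "'a::real_normed_vector \<Rightarrow> real"
  assumes "open U" "smooth_on U f" "smooth_on U g" "\<And>x. x \<in> U \<Longrightarrow> g x \<noteq> 0"
  shows "smooth_on U (\<lambda>x. f x / g x)"
  unfolding divide_inverse using assms by (intro smooth_on_mult smooth_on_inverse) auto

lemma smooth_on_ln:
  fixes f :: "'a::real_normed_vector \<Rightarrow> real"
  assumes "open U" "smooth_on U f" "\<And>x. x \<in> U \<Longrightarrow> f x > 0"
  shows "smooth_on U (\<lambda>x. ln (f x))"
  using assms by (intro smooth_on_compose_real[OF smooth_on_ln_real]) auto

text \<open>For positive \<open>f\<close> the root is \<open>exp (ln (f x) / 2)\<close>, a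
  composition of functions already treated.\<close>

lemma smooth_on_sqrt:
  fixes f :: "'a::real_normed_vector \<Rightarrow> real"
  assumes "open U" "smooth_on U f" "\<And>x. x \<in> U \<Longrightarrow> f x > 0"
  shows "smooth_on U (\<lambda>x. sqrt (f x))"
proof (rule smooth_on_cong[OF assms(1)])
  show "smooth_on U (\<lambda>x. exp (ln (f x) / 2))"
    using assms by (intro smooth_on_exp smooth_on_divide smooth_on_ln smooth_on_const) auto
  show "exp (ln (f x) / 2) = sqrt (f x)" if "x \<in> U" for x
    using assms(3)[OF that] ln_sqrt[of "f x", symmetric] by simp
qed

lemma smooth_on_cosh:
  fixes f :: "'a::real_normed_vector \<Rightarrow> real"
  assumes "open U" "smooth_on U f"
  shows "smooth_on U (\<lambda>x. cosh (f x))"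
  unfolding cosh_field_def using assms
  by (intro smooth_on_divide smooth_on_add smooth_on_exp smooth_on_minus smooth_on_const) auto

lemma smooth_on_tanh:
  fixes f :: "'a::real_normed_vector \<Rightarrow> real"
  assumes "open U" "smooth_on U f"
  shows "smooth_on U (\<lambda>x. tanh (f x))"
  unfolding tanh_def sinh_field_def using assms
  by (intro smooth_on_divide smooth_on_diff smooth_on_exp smooth_on_minus smooth_on_cosh smooth_on_const) auto

lemma smooth_on_artanh:
  fixes f :: "'a::real_normed_vector \<Rightarrow> real"
  assumes "open U" "smooth_on U f" "\<And>x. x \<in> U \<Longrightarrow> \<bar>f x\<bar> < 1"
  shows "smooth_on U (\<lambda>x. artanh (f x))"
  unfolding artanh_def
  using assms by (intro smooth_on_divide smooth_on_diff smooth_on_add smooth_on_ln smooth_on_const)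
    (force simp: abs_less_iff)+

section \<open>Vector-valued functions and integrals with a variable endpoint\<close>

lemma smooth_on_vec_nth:
  fixes f :: "'a::real_normed_vector \<Rightarrow> real^'n"
  shows "open U \<Longrightarrow> smooth_on U f \<Longrightarrow> smooth_on U (\<lambda>x. f x $ i)"
  using smooth_on_linear_compose[OF _ bounded_linear_vec_nth] .

text \<open>Turns the list notation into a linear combination of fixed vectors, so that smoothness
  and derivatives follow from linearity in each entry.\<close>

lemma vector_3_eq_axis:
  "vector [a, b, c] = a *\<^sub>R axis 1 1 + b *\<^sub>R axis 2 1 + c *\<^sub>R (axis 3 1 :: real^3)"
  by (simp add: vec_eq_iff forall_3 axis_def)

lemma smooth_on_vector_3:
  fixes f g h :: "'a::real_normed_vector \<Rightarrow> real"
  assumes "open U" "smooth_on U f" "smooth_on U g" "smooth_on U h"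
  shows "smooth_on U (\<lambda>x. vector [f x, g x, h x] :: real^3)"
proof -
  have "smooth_on U (\<lambda>x. f x *\<^sub>R v)" if "smooth_on U f" for f :: "'a \<Rightarrow> real" and v :: "real^3"
    using smooth_on_linear_compose[OF assms(1) bounded_linear_scaleR_left that] .
  with assms show ?thesis
    unfolding vector_3_eq_axis by (intro smooth_on_add) auto
qed

lemma has_vector_derivative_vector_3:
  assumes "(f has_real_derivative a) F" "(g has_real_derivative b) F" "(h has_real_derivative c) F"
  shows "((\<lambda>x. vector [f x, g x, h x] :: real^3) has_vector_derivative vector [a, b, c]) F"
  unfolding vector_3_eq_axis
  using assms unfolding has_real_derivative_iff_has_vector_derivative
  by (intro has_vector_derivative_add bounded_linear.has_vector_derivative[OF bounded_linear_scaleR_left])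

lemma has_vector_derivative_vec_nth:
  "(f has_vector_derivative v) F \<Longrightarrow> ((\<lambda>x. f x $ i) has_real_derivative v $ i) F"
  unfolding has_real_derivative_iff_has_vector_derivative
  by (rule bounded_linear.has_vector_derivative[OF bounded_linear_vec_nth])

lemma smooth_on_integral:
  fixes f :: "real \<Rightarrow> real" and a b :: ereal
  assumes f: "smooth_on (einterval a b) f" and t0: "t0 \<in> einterval a b"
  shows "t \<in> einterval a b \<Longrightarrow> ((\<lambda>t. LBINT u=t0..t. f u) has_real_derivative f t) (at t)"
    and "smooth_on (einterval a b) (\<lambda>t. LBINT u=t0..t. f u)"
proof -
  have c: "continuous_on (einterval a b) f"
    by (rule smooth_on_imp_continuous_on[OF f])
  show *: "((\<lambda>t. LBINT u=t0..t. f u) has_real_derivative f t) (at t)" if t: "t \<in> einterval a b" for t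
  proof -
    \<comment> \<open>The fundamental theorem is applied on a compact interval. It contains
      \<open>t0\<close> and \<open>t\<close> strictly inside, so the derivative within it is a
      two-sided derivative at \<open>t\<close>.\<close>
    obtain l r where lr: "l < min t0 t" "max t0 t < r" "{l..r} \<subseteq> einterval a b"
    proof -
      have "a < min (ereal t0) (ereal t)" "max (ereal t0) (ereal t) < b"
        using t0 t by (auto simp: einterval_iff)
      then obtain l r where "a < ereal l" "ereal l < min (ereal t0) (ereal t)"
          "max (ereal t0) (ereal t) < ereal r" "ereal r < b"
        by (meson ereal_dense2)
      moreover have "{l..r} \<subseteq> einterval a b"
      proof
        fix x assume "x \<in> {l..r}"
        then have "ereal l \<le> ereal x" "ereal x \<le> ereal r" by auto
        with calculation show "x \<in> einterval a b" unfolding einterval_iff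
          by (meson le_less_trans less_le_trans)
      qed
      ultimately show ?thesis by (intro that[of l r]) (auto simp: min_def max_def split: if_splits)
    qed
    have "((\<lambda>u. LBINT y=t0..u. f y) has_vector_derivative f t) (at t within {l..r})"
      using lr by (intro interval_integral_FTC2) (auto intro: continuous_on_subset[OF c])
    then show ?thesis
      using lr by (auto simp: has_real_derivative_iff_has_vector_derivative
          at_within_Icc_at)
  qed
  show "smooth_on (einterval a b) (\<lambda>t. LBINT u=t0..t. f u)"
    by (rule smooth_on_antiderivative[OF _ * f]) auto
qed

section \<open>Geodesics of the left-invariant metric\<close>

definition complex_matrix :: "complex \<Rightarrow> real^2^2" where
  "complex_matrix z = vector [vector [Re z, - Im z], vector [Im z, Re z]]"

lemma bounded_linear_complex_matrix: "bounded_linear complex_matrix"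
  by (intro linear_conv_bounded_linear[THEN iffD1] linearI)
    (simp_all add: complex_matrix_def vec_eq_iff forall_2)

lemma complex_matrix_mult: "complex_matrix (z * w) = complex_matrix z ** complex_matrix w"
  by (simp add: complex_matrix_def vec_eq_iff forall_2 matrix_matrix_mult_def sum_2 algebra_simps)

lemma complex_matrix_1: "complex_matrix 1 = mat 1"
  by (simp add: complex_matrix_def vec_eq_iff forall_2 mat_def)

text \<open>\<open>complex_matrix\<close> is a continuous algebra homomorphism, so it carries the
  complex exponential series to the matrix series term by term.\<close>

lemma mat_exp_complex_matrix: "mat_exp (complex_matrix z) = complex_matrix (exp z)"
proof -
  have power: "(((**) (complex_matrix z)) ^^ k) (mat 1) = complex_matrix (z ^ k)" for k
    by (induction k) (simp_all add: complex_matrix_1 complex_matrix_mult)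
  have "(\<lambda>k. complex_matrix (z ^ k /\<^sub>R fact k)) sums complex_matrix (exp z)"
    by (rule bounded_linear.sums[OF bounded_linear_complex_matrix exp_converges])
  then show ?thesis
    unfolding mat_exp_def power
    by (simp add: sums_iff linear_cmul[OF bounded_linear.linear[OF bounded_linear_complex_matrix]] inverse_eq_divide)
qed

text \<open>\<open>sol_matrix p\<close> represents the complex number \<open>p + i\<close>, whose
  multiples by \<open>x\<close> have the exponential
  \<open>exp (p * x) * (cos x + i * sin x)\<close>.\<close>

lemma mat_exp_sol_matrix:
  "mat_exp (x *\<^sub>R sol_matrix p) = exp (p * x) *\<^sub>R vector [vector [cos x, - sin x], vector [sin x, cos x]]"
proof -
  have "x *\<^sub>R sol_matrix p = complex_matrix (Complex (p * x) x)"
    by (simp add: sol_matrix_def complex_matrix_def vec_eq_iff forall_2)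
  then show ?thesis
    by (simp add: mat_exp_complex_matrix)
      (simp add: complex_matrix_def vec_eq_iff forall_2 Re_exp Im_exp)
qed

text \<open>The differential of left translation by a point with first coordinate \<open>x\<close>.
  It does not depend on where it is taken, since left translations are affine in these
  coordinates.\<close>

definition left_diff :: "real \<Rightarrow> real \<Rightarrow> real^3 \<Rightarrow> real^3" where
  "left_diff p x r = vector [r $ 1, exp (p * x) * (cos x * r $ 2 - sin x * r $ 3),
     exp (p * x) * (sin x * r $ 2 + cos x * r $ 3)]"

lemma sol_mult_eq: "sol_mult p q r = q + left_diff p (q $ 1) r"
  by (simp add: sol_mult_def left_diff_def Let_def mat_exp_sol_matrix vec_eq_iff forall_3
      matrix_vector_mult_def sum_2 algebra_simps)

lemma bounded_linear_left_diff: "bounded_linear (left_diff p x)"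
  by (intro linear_conv_bounded_linear[THEN iffD1] linearI)
    (simp_all add: left_diff_def vec_eq_iff forall_3 algebra_simps)

lemma sol_frame_eq: "sol_frame p i q = left_diff p (q $ 1) (axis i 1)"
proof -
  have "(sol_mult p q has_derivative left_diff p (q $ 1)) (at 0)"
    unfolding sol_mult_eq[abs_def]
    by (auto intro!: derivative_eq_intros bounded_linear_imp_has_derivative bounded_linear_left_diff)
  then show ?thesis
    unfolding sol_frame_def by (metis frechet_derivative_at)
qed

lemma sol_frame_1: "sol_frame p 1 q = axis 1 1"
  by (simp add: sol_frame_eq left_diff_def vec_eq_iff forall_3 axis_def)

text \<open>The right side undoes the rotation and scaling in \<open>left_diff\<close>. Being a
  right inverse gives existence, and being a left inverse gives uniqueness, of the coefficients in
  the definite description.\<close>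

lemma sol_coframe_eq:
  "sol_coframe p q v = vector [v $ 1,
     exp (- p * q $ 1) * (cos (q $ 1) * v $ 2 + sin (q $ 1) * v $ 3),
     exp (- p * q $ 1) * (cos (q $ 1) * v $ 3 - sin (q $ 1) * v $ 2)]" (is "_ = ?l v")
proof -
  let ?L = "left_diff p (q $ 1)"
  have sum: "(\<Sum>i\<in>UNIV. l $ i *\<^sub>R sol_frame p i q) = ?L l" for l :: "real^3"
    by (simp add: sum_3 sol_frame_eq left_diff_def vec_eq_iff forall_3 axis_def algebra_simps)
  have e: "exp (p * q $ 1) * exp (- p * q $ 1) = 1"
    by (simp flip: exp_add)
  have cs: "cos (q $ 1) * cos (q $ 1) + sin (q $ 1) * sin (q $ 1) = 1"
    by simp
  have "?L (?l v) = v" for v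
    unfolding left_diff_def vec_eq_iff forall_3 vector_3
    using e cs by (intro conjI refl; algebra)
  moreover have "?l (?L l) = l" for l
    unfolding left_diff_def vec_eq_iff forall_3 vector_3
    using e cs by (intro conjI refl; algebra)
  ultimately show ?thesis
    unfolding sol_coframe_def sum by (intro the_equality) metis+
qed

text \<open>The rotation by the angle \<open>q $ 1\<close> preserves the inner product of the last
  two entries, so only the scaling survives. The metric becomes diagonal, with entries that depend
  on the first coordinate alone.\<close>

lemma sol_metric_eq:
  "sol_metric p \<epsilon> \<alpha> q v w =
     \<epsilon>\<^sup>2 * (v $ 1 * w $ 1) + \<alpha>\<^sup>2 * exp (- 2 * p * q $ 1) * (v $ 2 * w $ 2 + v $ 3 * w $ 3)"
proof -
  have e: "exp (- 2 * p * q $ 1) = exp (- p * q $ 1) * exp (- p * q $ 1)"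
    by (simp flip: exp_add)
  have cs: "cos (q $ 1) * cos (q $ 1) + sin (q $ 1) * sin (q $ 1) = 1"
    by simp
  show ?thesis
    unfolding sol_metric_def sol_coframe_eq Let_def vector_3 e using cs by algebra
qed

section \<open>Christoffel symbols and the geodesic equation\<close>

lemma gram_sol_metric:
  "gram (sol_metric p \<epsilon> \<alpha>) q $ i $ j =
     (if i \<noteq> j then 0 else if i = 1 then \<epsilon>\<^sup>2 else \<alpha>\<^sup>2 * exp (- 2 * p * q $ 1))"
  using exhaust_3[of i] exhaust_3[of j] by (auto simp: gram_def sol_metric_eq axis_def)

text \<open>\<open>matrix_inv\<close> is a choice among two-sided inverses, so the explicit inverse
  is identified by the uniqueness of such inverses.\<close>

lemma matrix_inv_diag:
  fixes d :: "'n::finite \<Rightarrow> real"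
  assumes "\<And>i. d i \<noteq> 0"
  shows "matrix_inv (\<chi> i j. if i = j then d i else 0) = (\<chi> i j. if i = j then inverse (d i) else 0)"
    (is "matrix_inv ?D = ?E")
proof -
  have "(\<chi> i j. if i = j then e i else 0) ** (\<chi> i j. if i = j then f i else 0)
      = (\<chi> i j. if i = j then e i * f i else 0)" for e f :: "'n \<Rightarrow> real"
  proof -
    have "(if i = k then e i else 0) * (if k = j then f k else 0)
        = (if k = i then if i = j then e i * f i else 0 else 0)" for i j k
      by simp
    then show ?thesis
      by (simp add: vec_eq_iff matrix_matrix_mult_def)
  qed
  then have inv: "?D ** ?E = mat 1" "?E ** ?D = mat 1"
    using assms by (auto simp: mat_def vec_eq_iff)
  show ?thesis
    unfolding matrix_inv_def
  proof (rule some_equality)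
    fix B assume "?D ** B = mat 1 \<and> B ** ?D = mat 1"
    then have "?E ** (?D ** B) = ?E" by (simp add: matrix_mul_rid)
    moreover have "?E ** (?D ** B) = B"
      unfolding matrix_mul_assoc inv(2) by (rule matrix_mul_lid)
    ultimately show "B = ?E" by simp
  qed (use inv in simp)
qed

lemma matrix_inv_gram_sol_metric:
  assumes "\<epsilon> \<noteq> 0" "\<alpha> \<noteq> 0"
  shows "matrix_inv (gram (sol_metric p \<epsilon> \<alpha>) q) $ i $ j =
     (if i \<noteq> j then 0 else inverse (if i = 1 then \<epsilon>\<^sup>2 else \<alpha>\<^sup>2 * exp (- 2 * p * q $ 1)))"
proof -
  let ?d = "\<lambda>i::3. if i = 1 then \<epsilon>\<^sup>2 else \<alpha>\<^sup>2 * exp (- 2 * p * q $ 1)"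
  have "gram (sol_metric p \<epsilon> \<alpha>) q = (\<chi> i j. if i = j then ?d i else 0)"
    by (simp add: vec_eq_iff gram_sol_metric)
  then show ?thesis
    using assms by (simp add: matrix_inv_diag)
qed

lemma dgram_sol_metric:
  "dgram (sol_metric p \<epsilon> \<alpha>) l i j q =
     (if l = 1 \<and> i = j \<and> i \<noteq> 1 then - 2 * p * \<alpha>\<^sup>2 * exp (- 2 * p * q $ 1) else 0)"
proof (cases "i = j \<and> i \<noteq> 1")
  case True
  have "((\<lambda>r::real^3. \<alpha>\<^sup>2 * exp (- 2 * p * r $ 1)) has_derivative
      (\<lambda>h. \<alpha>\<^sup>2 * (exp (- 2 * p * q $ 1) * (- 2 * p * h $ 1)))) (at q)"
    by (auto intro!: derivative_eq_intros bounded_linear_imp_has_derivative)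
  note deriv = frechet_derivative_at[OF this, symmetric]
  have "(\<lambda>r. gram (sol_metric p \<epsilon> \<alpha>) r $ i $ j) = (\<lambda>r. \<alpha>\<^sup>2 * exp (- 2 * p * r $ 1))"
    using True by (auto simp: gram_sol_metric)
  then show ?thesis
    unfolding dgram_def by (simp only: deriv) (use True in \<open>auto simp: axis_def\<close>)
next
  case False
  then have "(\<lambda>r. gram (sol_metric p \<epsilon> \<alpha>) r $ i $ j) = (\<lambda>r. if i = j then \<epsilon>\<^sup>2 else 0)"
    by (auto simp: gram_sol_metric)
  then show ?thesis
    using False by (auto simp: dgram_def)
qed

text \<open>The symbols are contracted with the velocity at once, as they enter the geodesic
  equation. The factor 2 in the last two sums collects the equal symbols with lower indices
  \<open>1 j\<close> and \<open>j 1\<close>.\<close>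

lemma christoffel_sol_metric:
  fixes p \<epsilon> \<alpha> :: real and q v :: "real^3"
  assumes "\<epsilon> \<noteq> 0" "\<alpha> \<noteq> 0"
  defines "\<Gamma> \<equiv> christoffel (sol_metric p \<epsilon> \<alpha>) q"
  shows "(\<Sum>i\<in>UNIV. \<Sum>j\<in>UNIV. \<Gamma> 1 i j * v $ i * v $ j) =
      p * \<alpha>\<^sup>2 / \<epsilon>\<^sup>2 * exp (- 2 * p * q $ 1) * ((v $ 2)\<^sup>2 + (v $ 3)\<^sup>2)"
    and "(\<Sum>i\<in>UNIV. \<Sum>j\<in>UNIV. \<Gamma> 2 i j * v $ i * v $ j) = - 2 * p * v $ 1 * v $ 2"
    and "(\<Sum>i\<in>UNIV. \<Sum>j\<in>UNIV. \<Gamma> 3 i j * v $ i * v $ j) = - 2 * p * v $ 1 * v $ 3"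
  using assms(1,2) unfolding \<Gamma>_def christoffel_def
  by (simp_all add: sum_3 dgram_sol_metric matrix_inv_gram_sol_metric field_simps power2_eq_square)

lemma geodesic_on_sol_metric_iff:
  assumes "\<epsilon> \<noteq> 0" "\<alpha> \<noteq> 0"
  shows "geodesic_on (sol_metric p \<epsilon> \<alpha>) I c \<longleftrightarrow> (\<exists>v a. \<forall>\<tau>\<in>I.
     (c has_vector_derivative v \<tau>) (at \<tau> within I) \<and>
     (v has_vector_derivative a \<tau>) (at \<tau> within I) \<and>
     a \<tau> $ 1 = - (p * \<alpha>\<^sup>2 / \<epsilon>\<^sup>2 * exp (- 2 * p * c \<tau> $ 1) * ((v \<tau> $ 2)\<^sup>2 + (v \<tau> $ 3)\<^sup>2)) \<and>
     a \<tau> $ 2 = 2 * p * v \<tau> $ 1 * v \<tau> $ 2 \<and>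
     a \<tau> $ 3 = 2 * p * v \<tau> $ 1 * v \<tau> $ 3)"
proof -
  have z: "r + s = 0 \<longleftrightarrow> r = - s" for r s :: real by auto
  show ?thesis
    unfolding geodesic_on_def forall_3 christoffel_sol_metric[OF assms] z by simp
qed

text \<open>Written with \<open>w = exp (- p x)\<close>, the geodesic equations become linear.\<close>
lemma geodesic_on_sol_metricI:
  fixes w w' w'' y z :: "real \<Rightarrow> real"
  assumes "\<epsilon> \<noteq> 0" "\<alpha> \<noteq> 0" "p \<noteq> 0"
    and w: "\<And>\<tau>. \<tau> \<in> I \<Longrightarrow> w \<tau> > 0"
      "\<And>\<tau>. \<tau> \<in> I \<Longrightarrow> (w has_real_derivative w' \<tau>) (at \<tau> within I)"
      "\<And>\<tau>. \<tau> \<in> I \<Longrightarrow> (w' has_real_derivative w'' \<tau>) (at \<tau> within I)"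
      "\<And>\<tau>. \<tau> \<in> I \<Longrightarrow> w \<tau> * w'' \<tau> - (w' \<tau>)\<^sup>2 = p\<^sup>2 * \<alpha>\<^sup>2 / \<epsilon>\<^sup>2 * (C\<^sup>2 + D\<^sup>2)"
    and y: "\<And>\<tau>. \<tau> \<in> I \<Longrightarrow> (y has_real_derivative C / (w \<tau>)\<^sup>2) (at \<tau> within I)"
    and z: "\<And>\<tau>. \<tau> \<in> I \<Longrightarrow> (z has_real_derivative D / (w \<tau>)\<^sup>2) (at \<tau> within I)"
  shows "geodesic_on (sol_metric p \<epsilon> \<alpha>) I (\<lambda>\<tau>. vector [- ln (w \<tau>) / p, y \<tau>, z \<tau>])"
    and "\<tau> \<in> I \<Longrightarrow> ((\<lambda>\<tau>. vector [- ln (w \<tau>) / p, y \<tau>, z \<tau>] :: real^3) has_vector_derivative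
      vector [- w' \<tau> / (p * w \<tau>), C / (w \<tau>)\<^sup>2, D / (w \<tau>)\<^sup>2]) (at \<tau> within I)"
proof -
  define v where "v \<tau> = (vector [- w' \<tau> / (p * w \<tau>), C / (w \<tau>)\<^sup>2, D / (w \<tau>)\<^sup>2] :: real^3)" for \<tau>
  \<comment> \<open>The derivative of \<open>v\<close>. Its first entry contains
    \<open>w * w'' - w'^2\<close>, which the fourth assumption on \<open>w\<close> turns into the
    quadratic term of the geodesic equation.\<close>
  define a where "a \<tau> = (vector [- (w \<tau> * w'' \<tau> - (w' \<tau>)\<^sup>2) / (p * (w \<tau>)\<^sup>2),
      - 2 * C * w' \<tau> / (w \<tau>) ^ 3, - 2 * D * w' \<tau> / (w \<tau>) ^ 3] :: real^3)" for \<tau>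
  have c: "((\<lambda>\<tau>. vector [- ln (w \<tau>) / p, y \<tau>, z \<tau>]) has_vector_derivative v \<tau>) (at \<tau> within I)"
    if "\<tau> \<in> I" for \<tau>
    unfolding v_def
    by (intro has_vector_derivative_vector_3 y z that)
      (use w[OF that] \<open>p \<noteq> 0\<close> in \<open>auto intro!: derivative_eq_intros simp: field_simps\<close>)
  then show "\<tau> \<in> I \<Longrightarrow> ((\<lambda>\<tau>. vector [- ln (w \<tau>) / p, y \<tau>, z \<tau>] :: real^3) has_vector_derivative
      vector [- w' \<tau> / (p * w \<tau>), C / (w \<tau>)\<^sup>2, D / (w \<tau>)\<^sup>2]) (at \<tau> within I)"
    by (simp add: v_def)
  have v: "(v has_vector_derivative a \<tau>) (at \<tau> within I)" if "\<tau> \<in> I" for \<tau>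
    unfolding v_def[abs_def] a_def
    by (intro has_vector_derivative_vector_3)
      (use w(1)[OF that] \<open>p \<noteq> 0\<close> in \<open>auto intro!: derivative_eq_intros w(2,3)[OF that]
        simp: field_simps power2_eq_square power3_eq_cube power4_eq_xxxx\<close>)
  have e: "exp (- 2 * p * (- ln (w \<tau>) / p)) = (w \<tau>)\<^sup>2" if "\<tau> \<in> I" for \<tau>
  proof -
    have "exp (- 2 * p * (- ln (w \<tau>) / p)) = exp (ln (w \<tau>) * 2)" using \<open>p \<noteq> 0\<close> by simp
    also have "\<dots> = (w \<tau>)\<^sup>2" using w(1)[OF that] by (simp add: exp_double[of "ln (w \<tau>)"] mult.commute)
    finally show ?thesis .
  qed
  show "geodesic_on (sol_metric p \<epsilon> \<alpha>) I (\<lambda>\<tau>. vector [- ln (w \<tau>) / p, y \<tau>, z \<tau>])"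
    unfolding geodesic_on_sol_metric_iff[OF assms(1,2)]
  proof (intro exI ballI conjI)
    fix \<tau> assume \<tau>: "\<tau> \<in> I"
    show "a \<tau> $ 1 = - (p * \<alpha>\<^sup>2 / \<epsilon>\<^sup>2 * exp (- 2 * p * (vector [- ln (w \<tau>) / p, y \<tau>, z \<tau>] :: real^3) $ 1)
        * ((v \<tau> $ 2)\<^sup>2 + (v \<tau> $ 3)\<^sup>2))"
      using w(1)[OF \<tau>] assms(1-3) unfolding vector_3 e[OF \<tau>]
      by (simp add: a_def v_def w(4)[OF \<tau>] field_simps) (simp add: power2_eq_square algebra_simps)
    show "a \<tau> $ 2 = 2 * p * v \<tau> $ 1 * v \<tau> $ 2" "a \<tau> $ 3 = 2 * p * v \<tau> $ 1 * v \<tau> $ 3"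
      using w(1)[OF \<tau>] \<open>p \<noteq> 0\<close> by (simp_all add: a_def v_def field_simps power2_eq_square power3_eq_cube)
  qed (use c v in simp_all)
qed

section \<open>Uniqueness of geodesics and values of the exponential map\<close>

lemma has_real_derivative_zero_unit_interval:
  fixes f :: "real \<Rightarrow> real"
  assumes "\<And>\<tau>. \<tau> \<in> {0..1} \<Longrightarrow> (f has_real_derivative 0) (at \<tau> within {0..1})" "\<tau> \<in> {0..1}"
  shows "f \<tau> = f 0"
proof -
  obtain c where "\<forall>\<tau>\<in>{0..1}. f \<tau> = c"
    using has_field_derivative_zero_constant[of "{0..1}" f] assms(1) by blast
  with assms(2) show ?thesis by simp
qed

text \<open>The operator \<open>d'' - k * d\<close> factors through \<open>L = sqrt k\<close> into
  two first-order operators. First \<open>d' + L * d\<close> and then \<open>d\<close> itself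
  vanish, each time because the product with an exponential is constant; \<open>k = 0\<close> is
  covered too.\<close>

lemma linear_ode_zero:
  fixes d d' :: "real \<Rightarrow> real"
  assumes "k \<ge> 0" "d 0 = 0" "d' 0 = 0"
    and d: "\<And>\<tau>. \<tau> \<in> {0..1} \<Longrightarrow> (d has_real_derivative d' \<tau>) (at \<tau> within {0..1})"
    and d': "\<And>\<tau>. \<tau> \<in> {0..1} \<Longrightarrow> (d' has_real_derivative k * d \<tau>) (at \<tau> within {0..1})"
    and "\<tau> \<in> {0..1}"
  shows "d \<tau> = 0"
proof -
  define L where "L = sqrt k"
  have L: "k = L * L" using \<open>k \<ge> 0\<close> by (simp add: L_def)
  have d'_eq: "d' \<tau> = - L * d \<tau>" if "\<tau> \<in> {0..1}" for \<tau>
  proof -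
    have "((\<lambda>\<tau>. (d' \<tau> + L * d \<tau>) * exp (- L * \<tau>)) has_real_derivative 0) (at \<tau> within {0..1})"
      if "\<tau> \<in> {0..1}" for \<tau>
      using d[OF that] d'[OF that] by (auto intro!: derivative_eq_intros simp: L algebra_simps)
    from has_real_derivative_zero_unit_interval[OF this that] assms(2,3) show ?thesis
      by (simp add: eq_neg_iff_add_eq_0)
  qed
  have "((\<lambda>\<tau>. d \<tau> * exp (L * \<tau>)) has_real_derivative 0) (at \<tau> within {0..1})"
    if "\<tau> \<in> {0..1}" for \<tau>
    using d[OF that] by (auto intro!: derivative_eq_intros simp: d'_eq[OF that])
  from has_real_derivative_zero_unit_interval[OF this \<open>\<tau> \<in> {0..1}\<close>] \<open>d 0 = 0\<close> show ?thesis
    by simp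
qed

text \<open>The conserved momenta and energy are used to eliminate the velocity. What remains are
  equations whose right sides involve only the curve and its initial data, which is the form that
  the comparison of two geodesics uses.\<close>

lemma sol_geodesic_first_integrals:
  assumes "\<epsilon> \<noteq> 0" "\<alpha> \<noteq> 0"
    and "geodesic_on (sol_metric p \<epsilon> \<alpha>) {0..1} c"
    and u: "(c has_vector_derivative u) (at 0 within {0..1})"
  defines "k \<equiv> p\<^sup>2 * ((u $ 1)\<^sup>2 + \<alpha>\<^sup>2 / \<epsilon>\<^sup>2 * exp (- 2 * p * c 0 $ 1) * ((u $ 2)\<^sup>2 + (u $ 3)\<^sup>2))"
  obtains w' where "w' 0 = - p * u $ 1 * exp (- p * c 0 $ 1)"
    "\<And>\<tau>. \<tau> \<in> {0..1} \<Longrightarrow> ((\<lambda>\<tau>. exp (- p * c \<tau> $ 1)) has_real_derivative w' \<tau>) (at \<tau> within {0..1})"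
    "\<And>\<tau>. \<tau> \<in> {0..1} \<Longrightarrow> (w' has_real_derivative k * exp (- p * c \<tau> $ 1)) (at \<tau> within {0..1})"
    "\<And>\<tau>. \<tau> \<in> {0..1} \<Longrightarrow> ((\<lambda>\<tau>. c \<tau> $ 2) has_real_derivative
        u $ 2 * exp (- 2 * p * c 0 $ 1) / exp (- 2 * p * c \<tau> $ 1)) (at \<tau> within {0..1})"
    "\<And>\<tau>. \<tau> \<in> {0..1} \<Longrightarrow> ((\<lambda>\<tau>. c \<tau> $ 3) has_real_derivative
        u $ 3 * exp (- 2 * p * c 0 $ 1) / exp (- 2 * p * c \<tau> $ 1)) (at \<tau> within {0..1})"
proof -
  let ?I = "{0..1::real}" and ?e = "\<lambda>\<tau>. exp (- 2 * p * c \<tau> $ 1)"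
  from assms(3) obtain v a where
    v: "\<And>\<tau>. \<tau> \<in> ?I \<Longrightarrow> (c has_vector_derivative v \<tau>) (at \<tau> within ?I)" and
    a: "\<And>\<tau>. \<tau> \<in> ?I \<Longrightarrow> (v has_vector_derivative a \<tau>) (at \<tau> within ?I)" and
    a1: "\<And>\<tau>. \<tau> \<in> ?I \<Longrightarrow> a \<tau> $ 1 = - (p * \<alpha>\<^sup>2 / \<epsilon>\<^sup>2 * ?e \<tau> * ((v \<tau> $ 2)\<^sup>2 + (v \<tau> $ 3)\<^sup>2))" and
    a2: "\<And>\<tau>. \<tau> \<in> ?I \<Longrightarrow> a \<tau> $ 2 = 2 * p * v \<tau> $ 1 * v \<tau> $ 2" and
    a3: "\<And>\<tau>. \<tau> \<in> ?I \<Longrightarrow> a \<tau> $ 3 = 2 * p * v \<tau> $ 1 * v \<tau> $ 3"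
    unfolding geodesic_on_sol_metric_iff[OF assms(1,2)] by blast
  note c' = v[THEN has_vector_derivative_vec_nth] and v' = a[THEN has_vector_derivative_vec_nth]
  \<comment> \<open>Derivatives within \<open>{0..1}\<close> are unique even at the endpoint
    \<open>0\<close>, so the velocity from \<open>geodesic_on\<close> agrees with the prescribed
    one.\<close>
  have v0: "v 0 = u"
    using vector_derivative_unique_within[OF _ v u] by (simp add: trivial_limit_within islimpt_Icc)
  \<comment> \<open>These are the momenta of the translations in \<open>y\<close> and
    \<open>z\<close>, up to the factor \<open>\<alpha>^2\<close>.\<close>
  have C: "v \<tau> $ j * ?e \<tau> = u $ j * ?e 0" if "\<tau> \<in> ?I" "j \<in> {2, 3}" for \<tau> j
  proof -
    have "((\<lambda>\<tau>. v \<tau> $ j * ?e \<tau>) has_real_derivative 0) (at \<tau> within ?I)" if "\<tau> \<in> ?I" for \<tau>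
      using \<open>j \<in> {2, 3}\<close> a2[OF that] a3[OF that]
      by (auto intro!: derivative_eq_intros c'[OF that] v'[OF that] simp: algebra_simps)
    from has_real_derivative_zero_unit_interval[OF this \<open>\<tau> \<in> ?I\<close>] v0 show ?thesis by simp
  qed
  define \<kappa> where "\<kappa> = \<alpha>\<^sup>2 / \<epsilon>\<^sup>2"
  \<comment> \<open>The squared speed divided by \<open>\<epsilon>^2\<close>.\<close>
  define E where "E \<tau> = (v \<tau> $ 1)\<^sup>2 + \<kappa> * ?e \<tau> * ((v \<tau> $ 2)\<^sup>2 + (v \<tau> $ 3)\<^sup>2)" for \<tau>
  have E: "p\<^sup>2 * E \<tau> = k" if "\<tau> \<in> ?I" for \<tau>
  proof -
    have "(E has_real_derivative 0) (at \<tau> within ?I)" if "\<tau> \<in> ?I" for \<tau>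
    proof -
      have "(E has_real_derivative 2 * v \<tau> $ 1 * a \<tau> $ 1
          + \<kappa> * (?e \<tau> * (- 2 * p * v \<tau> $ 1)) * ((v \<tau> $ 2)\<^sup>2 + (v \<tau> $ 3)\<^sup>2)
          + \<kappa> * ?e \<tau> * (2 * v \<tau> $ 2 * a \<tau> $ 2 + 2 * v \<tau> $ 3 * a \<tau> $ 3)) (at \<tau> within ?I)"
        unfolding E_def[abs_def]
        by (rule derivative_eq_intros c'[OF that] v'[OF that] refl)+
          (simp add: algebra_simps)
      moreover have "a \<tau> $ 1 = - p * \<kappa> * ?e \<tau> * ((v \<tau> $ 2)\<^sup>2 + (v \<tau> $ 3)\<^sup>2)"
        by (simp add: a1[OF that] \<kappa>_def)
      ultimately show ?thesis
        by (simp add: a2[OF that] a3[OF that] algebra_simps power2_eq_square)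
    qed
    from has_real_derivative_zero_unit_interval[OF this that] v0 show ?thesis by (simp add: E_def k_def \<kappa>_def)
  qed
  show ?thesis
  proof (rule that)
    show "((\<lambda>\<tau>. exp (- p * c \<tau> $ 1)) has_real_derivative - p * v \<tau> $ 1 * exp (- p * c \<tau> $ 1)) (at \<tau> within ?I)"
      if "\<tau> \<in> ?I" for \<tau>
      by (auto intro!: derivative_eq_intros c'[OF that])
    show "((\<lambda>\<tau>. - p * v \<tau> $ 1 * exp (- p * c \<tau> $ 1)) has_real_derivative k * exp (- p * c \<tau> $ 1)) (at \<tau> within ?I)"
      if "\<tau> \<in> ?I" for \<tau>
      by (auto intro!: derivative_eq_intros c'[OF that] v'[OF that]
          simp: E[OF that, symmetric] E_def \<kappa>_def a1[OF that] algebra_simps power2_eq_square)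
    show "((\<lambda>\<tau>. c \<tau> $ 2) has_real_derivative u $ 2 * ?e 0 / ?e \<tau>) (at \<tau> within ?I)"
      "((\<lambda>\<tau>. c \<tau> $ 3) has_real_derivative u $ 3 * ?e 0 / ?e \<tau>) (at \<tau> within ?I)" if "\<tau> \<in> ?I" for \<tau>
    proof -
      have "v \<tau> $ j = u $ j * ?e 0 / ?e \<tau>" if "j \<in> {2, 3}" for j
        using C[OF \<open>\<tau> \<in> ?I\<close> that] by (simp add: nonzero_eq_divide_eq)
      note eq = this
      show "((\<lambda>\<tau>. c \<tau> $ 2) has_real_derivative u $ 2 * ?e 0 / ?e \<tau>) (at \<tau> within ?I)"
        "((\<lambda>\<tau>. c \<tau> $ 3) has_real_derivative u $ 3 * ?e 0 / ?e \<tau>) (at \<tau> within ?I)"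
        by (rule DERIV_cong[OF c'[OF that] eq]; simp)+
    qed
  qed (simp add: v0)
qed

text \<open>Both functions \<open>exp (- p * x)\<close> solve the same linear equation with the same
  initial values, so the first coordinates agree. The derivatives of the other coordinates are then
  equal as well.\<close>

lemma sol_geodesic_unique:
  assumes "\<epsilon> \<noteq> 0" "\<alpha> \<noteq> 0" "p \<noteq> 0"
    and "geodesic_on (sol_metric p \<epsilon> \<alpha>) {0..1} c" "geodesic_on (sol_metric p \<epsilon> \<alpha>) {0..1} d"
    and c: "(c has_vector_derivative u) (at 0 within {0..1})"
    and d: "(d has_vector_derivative u) (at 0 within {0..1})"
    and "c 0 = d 0" "\<tau> \<in> {0..1}"
  shows "c \<tau> = d \<tau>"
proof -
  let ?I = "{0..1::real}"
  define k where "k = p\<^sup>2 * ((u $ 1)\<^sup>2 + \<alpha>\<^sup>2 / \<epsilon>\<^sup>2 * exp (- 2 * p * d 0 $ 1) * ((u $ 2)\<^sup>2 + (u $ 3)\<^sup>2))"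
  obtain w1 where w1: "w1 0 = - p * u $ 1 * exp (- p * d 0 $ 1)"
    "\<And>\<tau>. \<tau> \<in> ?I \<Longrightarrow> ((\<lambda>\<tau>. exp (- p * c \<tau> $ 1)) has_real_derivative w1 \<tau>) (at \<tau> within ?I)"
    "\<And>\<tau>. \<tau> \<in> ?I \<Longrightarrow> (w1 has_real_derivative k * exp (- p * c \<tau> $ 1)) (at \<tau> within ?I)"
    "\<And>\<tau>. \<tau> \<in> ?I \<Longrightarrow> ((\<lambda>\<tau>. c \<tau> $ 2) has_real_derivative
        u $ 2 * exp (- 2 * p * d 0 $ 1) / exp (- 2 * p * c \<tau> $ 1)) (at \<tau> within ?I)"
    "\<And>\<tau>. \<tau> \<in> ?I \<Longrightarrow> ((\<lambda>\<tau>. c \<tau> $ 3) has_real_derivative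
        u $ 3 * exp (- 2 * p * d 0 $ 1) / exp (- 2 * p * c \<tau> $ 1)) (at \<tau> within ?I)"
    by (rule sol_geodesic_first_integrals[OF assms(1,2,4) c]) (simp_all add: k_def \<open>c 0 = d 0\<close>)
  obtain w2 where w2: "w2 0 = - p * u $ 1 * exp (- p * d 0 $ 1)"
    "\<And>\<tau>. \<tau> \<in> ?I \<Longrightarrow> ((\<lambda>\<tau>. exp (- p * d \<tau> $ 1)) has_real_derivative w2 \<tau>) (at \<tau> within ?I)"
    "\<And>\<tau>. \<tau> \<in> ?I \<Longrightarrow> (w2 has_real_derivative k * exp (- p * d \<tau> $ 1)) (at \<tau> within ?I)"
    "\<And>\<tau>. \<tau> \<in> ?I \<Longrightarrow> ((\<lambda>\<tau>. d \<tau> $ 2) has_real_derivative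
        u $ 2 * exp (- 2 * p * d 0 $ 1) / exp (- 2 * p * d \<tau> $ 1)) (at \<tau> within ?I)"
    "\<And>\<tau>. \<tau> \<in> ?I \<Longrightarrow> ((\<lambda>\<tau>. d \<tau> $ 3) has_real_derivative
        u $ 3 * exp (- 2 * p * d 0 $ 1) / exp (- 2 * p * d \<tau> $ 1)) (at \<tau> within ?I)"
    by (rule sol_geodesic_first_integrals[OF assms(1,2,5) d]) (simp_all add: k_def)
  have "k \<ge> 0" by (simp add: k_def)
  have "exp (- p * c \<tau> $ 1) - exp (- p * d \<tau> $ 1) = 0" if "\<tau> \<in> ?I" for \<tau>
  proof (rule linear_ode_zero[OF \<open>k \<ge> 0\<close> _ _ DERIV_diff[OF w1(2) w2(2)]])
    show "((\<lambda>\<tau>. w1 \<tau> - w2 \<tau>) has_real_derivative k * (exp (- p * c \<tau> $ 1) - exp (- p * d \<tau> $ 1)))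
        (at \<tau> within ?I)" if "\<tau> \<in> ?I" for \<tau>
      using DERIV_diff[OF w1(3)[OF that] w2(3)[OF that]] by (simp add: right_diff_distrib)
  qed (use that in \<open>simp_all add: \<open>c 0 = d 0\<close> w1(1) w2(1)\<close>)
  then have 1: "c \<tau> $ 1 = d \<tau> $ 1" if "\<tau> \<in> ?I" for \<tau>
    using that \<open>p \<noteq> 0\<close> by auto
  have "c \<tau> $ j = d \<tau> $ j" if "\<tau> \<in> ?I" "j \<in> {2, 3}" for \<tau> j
  proof -
    have "((\<lambda>\<tau>. c \<tau> $ j - d \<tau> $ j) has_real_derivative 0) (at \<tau> within ?I)" if "\<tau> \<in> ?I" for \<tau>
      using DERIV_diff[OF w1(4)[OF that] w2(4)[OF that]] DERIV_diff[OF w1(5)[OF that] w2(5)[OF that]]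
        \<open>j \<in> {2, 3}\<close> 1[OF that] by auto
    from has_real_derivative_zero_unit_interval[OF this \<open>\<tau> \<in> ?I\<close>] \<open>c 0 = d 0\<close> show ?thesis by simp
  qed
  with 1 \<open>\<tau> \<in> ?I\<close> show ?thesis
    by (simp add: vec_eq_iff forall_3)
qed

text \<open>\<open>riem_exp\<close> is a definite description; exhibiting one geodesic determines
  its value because the geodesic with given initial data is unique.\<close>

lemma riem_exp_sol_metric_eq:
  assumes "\<epsilon> \<noteq> 0" "\<alpha> \<noteq> 0" "p \<noteq> 0"
    and "geodesic_on (sol_metric p \<epsilon> \<alpha>) {0..1} c" "c 0 = q"
    and "(c has_vector_derivative v) (at 0 within {0..1})"
  shows "riem_exp (sol_metric p \<epsilon> \<alpha>) q v = c 1"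
  unfolding riem_exp_def
proof (rule the_equality)
  fix r assume "\<exists>d. geodesic_on (sol_metric p \<epsilon> \<alpha>) {0..1} d \<and> d 0 = q \<and>
    (d has_vector_derivative v) (at 0 within {0..1}) \<and> d 1 = r"
  then show "r = c 1"
    using sol_geodesic_unique[OF assms(1-3) _ assms(4) _ assms(6), of _ 1] assms(5) by auto
qed (use assms in blast)

text \<open>A geodesic on the whole line, run at \<open>s\<close> times its speed over
  \<open>{0..1}\<close>, has \<open>s\<close> times the initial velocity and ends at parameter
  \<open>s\<close>. Negative \<open>s\<close> and \<open>s = 0\<close> are included.\<close>

lemma riem_exp_sol_metricI:
  fixes w w' w'' y z :: "real \<Rightarrow> real"
  assumes "\<epsilon> \<noteq> 0" "\<alpha> \<noteq> 0" "p \<noteq> 0"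
    and w: "\<And>\<tau>. w \<tau> > 0"
      "\<And>\<tau>. (w has_real_derivative w' \<tau>) (at \<tau>)"
      "\<And>\<tau>. (w' has_real_derivative w'' \<tau>) (at \<tau>)"
      "\<And>\<tau>. w \<tau> * w'' \<tau> - (w' \<tau>)\<^sup>2 = p\<^sup>2 * \<alpha>\<^sup>2 / \<epsilon>\<^sup>2 * (C\<^sup>2 + D\<^sup>2)"
    and y: "\<And>\<tau>. (y has_real_derivative C / (w \<tau>)\<^sup>2) (at \<tau>)"
    and z: "\<And>\<tau>. (z has_real_derivative D / (w \<tau>)\<^sup>2) (at \<tau>)"
  shows "riem_exp (sol_metric p \<epsilon> \<alpha>) (vector [- ln (w 0) / p, y 0, z 0])
      (s *\<^sub>R vector [- w' 0 / (p * w 0), C / (w 0)\<^sup>2, D / (w 0)\<^sup>2]) = vector [- ln (w s) / p, y s, z s]"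
proof -
  have chain: "((\<lambda>\<tau>. f (s * \<tau>)) has_real_derivative s * f') (at \<tau> within {0..1})"
    if "(f has_real_derivative f') (at (s * \<tau>))" for f f' \<tau>
  proof -
    have "((\<lambda>\<tau>. s * \<tau>) has_real_derivative s) (at \<tau> within {0..1})"
      by (auto intro!: derivative_eq_intros)
    from DERIV_chain2[where f = f and g = "\<lambda>\<tau>. s * \<tau>" and x = \<tau>, OF that this] show ?thesis
      by (simp add: mult.commute)
  qed
  have "w (s * \<tau>) * (s * (s * w'' (s * \<tau>))) - (s * w' (s * \<tau>))\<^sup>2
      = p\<^sup>2 * \<alpha>\<^sup>2 / \<epsilon>\<^sup>2 * ((s * C)\<^sup>2 + (s * D)\<^sup>2)" for \<tau>
  proof -
    have "w (s * \<tau>) * (s * (s * w'' (s * \<tau>))) - (s * w' (s * \<tau>))\<^sup>2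
        = s\<^sup>2 * (w (s * \<tau>) * w'' (s * \<tau>) - (w' (s * \<tau>))\<^sup>2)"
      by (simp add: algebra_simps power2_eq_square)
    also have "\<dots> = p\<^sup>2 * \<alpha>\<^sup>2 / \<epsilon>\<^sup>2 * (s\<^sup>2 * (C\<^sup>2 + D\<^sup>2))"
      unfolding w(4) by simp
    finally show ?thesis by (simp add: power_mult_distrib distrib_left)
  qed
  then have geo: "geodesic_on (sol_metric p \<epsilon> \<alpha>) {0..1}
      (\<lambda>\<tau>. vector [- ln (w (s * \<tau>)) / p, y (s * \<tau>), z (s * \<tau>)])"
    "((\<lambda>\<tau>. vector [- ln (w (s * \<tau>)) / p, y (s * \<tau>), z (s * \<tau>)] :: real^3) has_vector_derivative
      vector [- (s * w' (s * 0)) / (p * w (s * 0)), s * C / (w (s * 0))\<^sup>2, s * D / (w (s * 0))\<^sup>2])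
      (at 0 within {0..1})"
    using chain[OF w(2)] DERIV_cmult[OF chain[OF w(3)], of s] chain[OF y] chain[OF z] w(1)
    by (intro geodesic_on_sol_metricI[OF assms(1-3), where C = "s * C" and D = "s * D" and
          w = "\<lambda>\<tau>. w (s * \<tau>)" and w' = "\<lambda>\<tau>. s * w' (s * \<tau>)" and w'' = "\<lambda>\<tau>. s * (s * w'' (s * \<tau>))"
          and I = "{0..1}"]; simp)+
  have v: "s *\<^sub>R vector [- w' 0 / (p * w 0), C / (w 0)\<^sup>2, D / (w 0)\<^sup>2] =
      (vector [- (s * w' (s * 0)) / (p * w (s * 0)), s * C / (w (s * 0))\<^sup>2, s * D / (w (s * 0))\<^sup>2] :: real^3)"
    by (simp add: vec_eq_iff forall_3)
  show ?thesis
    unfolding v by (subst riem_exp_sol_metric_eq[OF assms(1-3) geo(1) _ geo(2)]) simp_all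
qed

section \<open>Surfaces ruled by geodesics in normal form\<close>

lemma convex_einterval: "convex (einterval a b)"
  unfolding is_interval_convex_1[symmetric] is_interval_1
proof (intro ballI allI impI)
  fix x y z assume "x \<in> einterval a b" "y \<in> einterval a b" "x \<le> z \<and> z \<le> y"
  then have "a < ereal x" "ereal x \<le> ereal z" "ereal z \<le> ereal y" "ereal y < b"
    by (auto simp: einterval_iff)
  then show "z \<in> einterval a b"
    unfolding einterval_iff using less_le_trans le_less_trans by blast
qed

lemma smooth_eq_integral:
  fixes f h :: "real \<Rightarrow> real" and a b :: ereal
  assumes f: "\<And>u. u \<in> einterval a b \<Longrightarrow> (f has_real_derivative h u) (at u)"
    and h: "smooth_on (einterval a b) h"
    and t: "t0 \<in> einterval a b" "t \<in> einterval a b"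
  shows "f t = f t0 + (LBINT u=t0..t. h u)"
proof -
  have "((\<lambda>t. f t - (LBINT u=t0..t. h u)) has_real_derivative 0) (at u within einterval a b)"
    if "u \<in> einterval a b" for u
    using DERIV_diff[OF f[OF that] smooth_on_integral(1)[OF h t(1) that]]
    by (simp add: has_field_derivative_at_within)
  then obtain c where "\<forall>t\<in>einterval a b. f t - (LBINT u=t0..t. h u) = c"
    using has_field_derivative_zero_constant[OF convex_einterval, of a b "\<lambda>t. f t - (LBINT u=t0..t. h u)"]
    by blast
  with t have "f t - (LBINT u=t0..t. h u) = c" "f t0 - (LBINT u=t0..t0. h u) = c" by blast+
  then show ?thesis by simp
qed

text \<open>A smooth curve on the unit circle lifts to a smooth angle. The lift integrates the
  angular velocity from an angle at \<open>t0\<close>; the inner product of \<open>(f, g)\<close>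
  with \<open>(cos, sin)\<close> of the lift has derivative zero and starts at 1, and unit vectors
  with inner product 1 coincide.\<close>

lemma smooth_angle:
  fixes f g :: "real \<Rightarrow> real" and a b :: ereal
  assumes f: "smooth_on (einterval a b) f" and g: "smooth_on (einterval a b) g"
    and fg: "\<And>t. t \<in> einterval a b \<Longrightarrow> (f t)\<^sup>2 + (g t)\<^sup>2 = 1"
    and t0: "t0 \<in> einterval a b"
  obtains \<phi> where "smooth_on (einterval a b) \<phi>"
    "\<And>t. t \<in> einterval a b \<Longrightarrow> f t = cos (\<phi> t) \<and> g t = sin (\<phi> t)"
proof -
  let ?I = "einterval a b"
  define \<omega> where "\<omega> t = f t * deriv g t - g t * deriv f t" for t
  have \<omega>: "smooth_on ?I \<omega>"
    unfolding \<omega>_def[abs_def]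
    by (intro smooth_on_diff smooth_on_mult smooth_on_real_deriv f g open_einterval)
  obtain \<phi>0 where \<phi>0: "f t0 = cos \<phi>0" "g t0 = sin \<phi>0"
    using sincos_total_2pi[OF fg[OF t0]] by metis
  define \<phi> where "\<phi> t = \<phi>0 + (LBINT u=t0..t. \<omega> u)" for t
  have \<phi>': "(\<phi> has_real_derivative \<omega> t) (at t)" if "t \<in> ?I" for t
    using DERIV_add[OF DERIV_const smooth_on_integral(1)[OF \<omega> t0 that]] by (simp add: \<phi>_def[abs_def])
  have U': "((\<lambda>t. f t * cos (\<phi> t) + g t * sin (\<phi> t)) has_real_derivative 0) (at t within ?I)"
    if t: "t \<in> ?I" for t
  proof -
    note f' = smooth_on_DERIV[OF f t] and g' = smooth_on_DERIV[OF g t]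
    have "((\<lambda>t. (f t)\<^sup>2 + (g t)\<^sup>2) has_real_derivative 2 * f t * deriv f t + 2 * g t * deriv g t) (at t)"
      by (auto intro!: derivative_eq_intros f' g')
    moreover have "((\<lambda>t. (f t)\<^sup>2 + (g t)\<^sup>2) has_real_derivative 0) (at t)"
      by (rule has_field_derivative_transform_within_open[OF DERIV_const[of 1] open_einterval t])
        (simp add: fg)
    ultimately have "2 * f t * deriv f t + 2 * g t * deriv g t = 0"
      by (rule DERIV_unique)
    \<comment> \<open>The derivative of a unit vector is orthogonal to it, hence
      \<open>\<omega> t\<close> times the vector turned by a right angle.\<close>
    then have "deriv f t = - g t * \<omega> t" "deriv g t = f t * \<omega> t"
      using fg[OF t] unfolding \<omega>_def by algebra+
    moreover have "((\<lambda>t. f t * cos (\<phi> t) + g t * sin (\<phi> t)) has_real_derivative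
        deriv f t * cos (\<phi> t) - f t * \<omega> t * sin (\<phi> t)
        + (deriv g t * sin (\<phi> t) + g t * \<omega> t * cos (\<phi> t))) (at t)"
      by (auto intro!: derivative_eq_intros f' g' \<phi>'[OF t])
    ultimately have "((\<lambda>t. f t * cos (\<phi> t) + g t * sin (\<phi> t)) has_real_derivative 0) (at t)"
      by simp
    then show ?thesis
      by (rule has_field_derivative_at_within)
  qed
  obtain c where c: "\<forall>t\<in>?I. f t * cos (\<phi> t) + g t * sin (\<phi> t) = c"
    using has_field_derivative_zero_constant[OF convex_einterval, of a b "\<lambda>t. f t * cos (\<phi> t) + g t * sin (\<phi> t)"] U'
    by blast
  have "\<phi> t0 = \<phi>0" by (simp add: \<phi>_def)
  then have "f t0 * cos (\<phi> t0) + g t0 * sin (\<phi> t0) = 1"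
    unfolding \<phi>0 by simp
  with c t0 have "c = 1" by simp
  with c have U: "f t * cos (\<phi> t) + g t * sin (\<phi> t) = 1" if "t \<in> ?I" for t
    using that by blast
  \<comment> \<open>The left side expands to 2 minus twice the inner product.\<close>
  have "(f t - cos (\<phi> t))\<^sup>2 + (g t - sin (\<phi> t))\<^sup>2 = 0" if "t \<in> ?I" for t
    using U[OF that] fg[OF that] sin_cos_squared_add2[of "\<phi> t"] by algebra
  then have "f t = cos (\<phi> t) \<and> g t = sin (\<phi> t)" if "t \<in> ?I" for t
    using that by (simp add: sum_power2_eq_zero_iff)
  moreover have "smooth_on ?I \<phi>"
    by (rule smooth_on_antiderivative[OF open_einterval \<phi>' \<omega>])
  ultimately show ?thesis using that by blast
qed

lemma surf_t_eq:
  assumes "open T" "t \<in> T" "\<And>t. t \<in> T \<Longrightarrow> F (t, s) = G t" "(G has_vector_derivative d) (at t)"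
  shows "surf_t F (t, s) = d"
  unfolding surf_t_def prod.case
  by (rule vector_derivative_at, rule has_vector_derivative_transform_within_open[OF assms(4,1,2)])
    (simp add: assms(3))

lemma surf_s_eq:
  assumes "open S" "s \<in> S" "\<And>s. s \<in> S \<Longrightarrow> F (t, s) = G s" "(G has_vector_derivative d) (at s)"
  shows "surf_s F (t, s) = d"
  unfolding surf_s_def prod.case
  by (rule vector_derivative_at, rule has_vector_derivative_transform_within_open[OF assms(4,1,2)])
    (simp add: assms(3))

lemma cosh_square_tanh: "(cosh x)\<^sup>2 * (1 - (tanh x)\<^sup>2) = (1::real)"
proof -
  have "cosh x * tanh x = sinh x" by (simp add: tanh_def)
  with hyperbolic_pythagoras[of x] show ?thesis by algebra
qed

lemma affine_zero_on_open:
  fixes a b :: real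
  assumes "open S" "S \<noteq> {}" "\<And>s. s \<in> S \<Longrightarrow> a * s + b = 0"
  shows "a = 0" "b = 0"
proof -
  obtain s0 where s0: "s0 \<in> S" using assms(2) by blast
  obtain e where "e > 0" "ball s0 e \<subseteq> S" using assms(1) s0 openE by blast
  then have "s0 + e / 2 \<in> S" by (auto simp: dist_real_def)
  from assms(3)[OF this] assms(3)[OF s0] have "a * (e / 2) = 0"
    unfolding distrib_left by linarith
  with \<open>e > 0\<close> show "a = 0" by simp
  with assms(3)[OF s0] show "b = 0" by simp
qed

section \<open>Geodesics in normal form and the metric along them\<close>

locale sol_params =
  fixes p \<epsilon> \<alpha> :: real
  assumes eps: "\<epsilon> > 0" and al: "\<alpha> > 0" and p: "p \<noteq> 0"
begin

abbreviation g :: "3 metric_tensor" where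
  "g \<equiv> sol_metric p \<epsilon> \<alpha>"

lemma metric_pos:
  assumes "u \<noteq> 0"
  shows "g q u u > 0"
proof -
  have "u $ 1 \<noteq> 0 \<or> u $ 2 \<noteq> 0 \<or> u $ 3 \<noteq> 0" using assms by (simp add: vec_eq_iff forall_3)
  then consider "u $ 1 \<noteq> 0" | "(u $ 2)\<^sup>2 + (u $ 3)\<^sup>2 \<noteq> 0" by (auto simp: sum_power2_eq_zero_iff)
  then show ?thesis
  proof cases
    case 1
    then have "\<epsilon>\<^sup>2 * (u $ 1 * u $ 1) > 0" using eps by (simp add: zero_less_mult_iff) linarith
    then show ?thesis unfolding sol_metric_eq by (rule add_pos_nonneg) simp
  next
    case 2
    then have "(u $ 2)\<^sup>2 + (u $ 3)\<^sup>2 > 0" by (simp add: less_le)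
    then have "\<alpha>\<^sup>2 * exp (- 2 * p * q $ 1) * (u $ 2 * u $ 2 + u $ 3 * u $ 3) > 0"
      using al by (simp add: power2_eq_square)
    then show ?thesis unfolding sol_metric_eq by (intro add_nonneg_pos) simp_all
  qed
qed

text \<open>The last two coordinates stay on a segment with midpoint \<open>(Y, Z)\<close> and ends
  at \<open>(P, Q)\<close> to either side of it. \<open>A\<close> is the extreme value of the first
  coordinate, taken at \<open>\<tau> = 0\<close>.\<close>

definition normal_form :: "real \<Rightarrow> real \<Rightarrow> real \<Rightarrow> real \<Rightarrow> real \<Rightarrow> real \<Rightarrow> real^3" where
  "normal_form A P Q Y Z \<tau> = vector [A - ln (cosh \<tau>) / p, Y + P * tanh \<tau>, Z + Q * tanh \<tau>]"

text \<open>The condition under which \<open>\<tau> \<mapsto> normal_form A P Q Y Z \<tau>\<close> is a geodesic.\<close>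
definition form_cond :: "real \<Rightarrow> real \<Rightarrow> real \<Rightarrow> bool" where
  "form_cond A P Q \<longleftrightarrow> P\<^sup>2 + Q\<^sup>2 = (\<epsilon> / (p * \<alpha>))\<^sup>2 * exp (2 * p * A)"

text \<open>The geometric reading of \<open>form_cond\<close>: at height \<open>A\<close> the
  horizontal vector \<open>(P, Q)\<close> has length
  \<open>\<epsilon> / \<bar>p\<bar>\<close>.\<close>

lemma form_cond_metric: "form_cond A P Q \<Longrightarrow> \<alpha>\<^sup>2 * exp (- 2 * p * A) * (P\<^sup>2 + Q\<^sup>2) = \<epsilon>\<^sup>2 / p\<^sup>2"
proof -
  assume "form_cond A P Q"
  then have "\<alpha>\<^sup>2 * exp (- 2 * p * A) * (P\<^sup>2 + Q\<^sup>2) =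
      \<alpha>\<^sup>2 * (\<epsilon> / (p * \<alpha>))\<^sup>2 * (exp (- 2 * p * A) * exp (2 * p * A))"
    by (simp add: form_cond_def)
  also have "exp (- 2 * p * A) * exp (2 * p * A) = 1" by (simp flip: exp_add)
  also have "\<alpha>\<^sup>2 * (\<epsilon> / (p * \<alpha>))\<^sup>2 * 1 = \<epsilon>\<^sup>2 / p\<^sup>2" using al by (simp add: power_divide power_mult_distrib)
  finally show ?thesis .
qed

text \<open>Evaluating the conformal factor at height \<open>A - ln (cosh \<tau>) / p\<close>
  produces the square of \<open>cosh \<tau>\<close>, which later cancels against
  \<open>1 - tanh^2\<close>.\<close>

lemma metric_normal_form:
  "g (normal_form A P Q Y Z \<tau>) v w = \<epsilon>\<^sup>2 * (v $ 1 * w $ 1)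
     + \<alpha>\<^sup>2 * exp (- 2 * p * A) * (cosh \<tau>)\<^sup>2 * (v $ 2 * w $ 2 + v $ 3 * w $ 3)"
proof -
  have "- 2 * p * (A - ln (cosh \<tau>) / p) = - 2 * p * A + (ln (cosh \<tau>) + ln (cosh \<tau>))"
    using p by (simp add: field_simps)
  then have "exp (- 2 * p * (A - ln (cosh \<tau>) / p)) = exp (- 2 * p * A) * (cosh \<tau>)\<^sup>2"
    by (simp only: exp_add exp_ln cosh_real_pos power2_eq_square)
  then show ?thesis by (simp add: sol_metric_eq normal_form_def)
qed

text \<open>All parameters may vary together, so the same formula serves both partial derivatives;
  along a ruling only \<open>\<tau>\<close> varies.\<close>

lemma normal_form_deriv:
  assumes "(A has_real_derivative A') F" "(P has_real_derivative P') F" "(Q has_real_derivative Q') F"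
    "(Y has_real_derivative Y') F" "(Z has_real_derivative Z') F" "(\<tau> has_real_derivative \<tau>') F"
    and F: "F = at t within R"
  shows "((\<lambda>t. normal_form (A t) (P t) (Q t) (Y t) (Z t) (\<tau> t)) has_vector_derivative
    vector [A' - tanh (\<tau> t) * \<tau>' / p, Y' + P' * tanh (\<tau> t) + P t * (1 - (tanh (\<tau> t))\<^sup>2) * \<tau>',
      Z' + Q' * tanh (\<tau> t) + Q t * (1 - (tanh (\<tau> t))\<^sup>2) * \<tau>']) F"
  unfolding normal_form_def using assms(1-6) unfolding F
  using p by (intro has_vector_derivative_vector_3)
    (auto intro!: derivative_eq_intros simp: algebra_simps,
      simp_all add: tanh_def field_simps)

lemma normal_form_deriv_s:
  "((\<lambda>s. normal_form A P Q Y Z (m * s + c)) has_vector_derivative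
    m *\<^sub>R vector [- tanh (m * s + c) / p, P * (1 - (tanh (m * s + c))\<^sup>2), Q * (1 - (tanh (m * s + c))\<^sup>2)])
    (at s)"
proof -
  have "((\<lambda>s. m * s + c) has_real_derivative m) (at s)" by (auto intro!: derivative_eq_intros)
  from normal_form_deriv[OF DERIV_const DERIV_const DERIV_const DERIV_const DERIV_const this refl]
  show ?thesis
    by (rule back_subst[of "\<lambda>v. (_ has_vector_derivative v) _"]) (simp add: vec_eq_iff forall_3)
qed

text \<open>The second assumption is the derivative of \<open>form_cond\<close>. It makes the two
  terms with \<open>A' * tanh \<tau>\<close> cancel, and the terms with \<open>\<tau>'\<close> add
  up to a multiple that is free of \<open>\<tau>\<close>.\<close>

lemma metric_normal_form_ts:
  assumes "form_cond A P Q" "P * P' + Q * Q' = p * A' * (P\<^sup>2 + Q\<^sup>2)"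
  shows "g (normal_form A P Q Y Z \<tau>)
    (vector [A' - tanh \<tau> * \<tau>' / p, Y' + P' * tanh \<tau> + P * (1 - (tanh \<tau>)\<^sup>2) * \<tau>',
      Z' + Q' * tanh \<tau> + Q * (1 - (tanh \<tau>)\<^sup>2) * \<tau>'])
    (m *\<^sub>R vector [- tanh \<tau> / p, P * (1 - (tanh \<tau>)\<^sup>2), Q * (1 - (tanh \<tau>)\<^sup>2)])
    = m * (\<epsilon>\<^sup>2 / p\<^sup>2 * \<tau>' + \<alpha>\<^sup>2 * exp (- 2 * p * A) * (P * Y' + Q * Z'))"
proof -
  \<comment> \<open>With \<open>r\<close> for the reciprocal and \<open>N\<close> for the
    exponential factor the goal is polynomial, so \<open>algebra\<close> can use the relations among
    them.\<close>
  define r where "r = 1 / p"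
  define N where "N = \<alpha>\<^sup>2 * exp (- 2 * p * A)"
  have r: "p * r = 1" and e: "\<epsilon>\<^sup>2 / p\<^sup>2 = \<epsilon>\<^sup>2 * r\<^sup>2" and d: "x / p = x * r" for x
    using p by (simp_all add: r_def power_divide)
  have N: "N * (P\<^sup>2 + Q\<^sup>2) = \<epsilon>\<^sup>2 * r\<^sup>2"
    using form_cond_metric[OF assms(1)] by (simp add: N_def e)
  note K = cosh_square_tanh[of \<tau>]
  show ?thesis
    unfolding metric_normal_form e d N_def[symmetric] vector_3 vector_scaleR_component real_scaleR_def
    using K N r assms(2) by algebra
qed

lemma metric_normal_form_ss:
  assumes "form_cond A P Q"
  shows "g (normal_form A P Q Y Z \<tau>)
    (m *\<^sub>R vector [- tanh \<tau> / p, P * (1 - (tanh \<tau>)\<^sup>2), Q * (1 - (tanh \<tau>)\<^sup>2)])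
    (m *\<^sub>R vector [- tanh \<tau> / p, P * (1 - (tanh \<tau>)\<^sup>2), Q * (1 - (tanh \<tau>)\<^sup>2)])
    = \<epsilon>\<^sup>2 * m\<^sup>2 / p\<^sup>2"
proof -
  \<comment> \<open>The velocity along a ruling is the general derivative with frozen parameters and
    \<open>\<tau>' = 1\<close>, so the mixed formula applies to it.\<close>
  have "vector [- tanh \<tau> / p, P * (1 - (tanh \<tau>)\<^sup>2), Q * (1 - (tanh \<tau>)\<^sup>2)]
    = (vector [0 - tanh \<tau> * 1 / p, 0 + 0 * tanh \<tau> + P * (1 - (tanh \<tau>)\<^sup>2) * 1,
       0 + 0 * tanh \<tau> + Q * (1 - (tanh \<tau>)\<^sup>2) * 1] :: real^3)"
    by simp
  moreover have "g q (m *\<^sub>R v) w = m * g q v w" for q v w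
    by (simp add: sol_metric_eq algebra_simps)
  ultimately show ?thesis
    using metric_normal_form_ts[OF assms, of 0 0 0 Y Z \<tau> 1 0 0 m] by (simp add: power2_eq_square)
qed

lemma riem_exp_normal_form:
  assumes "form_cond A P Q"
  shows "riem_exp g (normal_form A P Q Y Z c)
      (s *\<^sub>R m *\<^sub>R vector [- tanh c / p, P * (1 - (tanh c)\<^sup>2), Q * (1 - (tanh c)\<^sup>2)])
    = normal_form A P Q Y Z (m * s + c)"
proof -
  \<comment> \<open>This is \<open>exp (- p * x)\<close> along the normal form, with its first two
    derivatives below.\<close>
  define w where "w \<tau> = exp (- p * A) * cosh (m * \<tau> + c)" for \<tau>
  define w' where "w' \<tau> = exp (- p * A) * m * sinh (m * \<tau> + c)" for \<tau>
  define w'' where "w'' \<tau> = exp (- p * A) * m * m * cosh (m * \<tau> + c)" for \<tau>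
  let ?e = "exp (- 2 * p * A)"
  have ee: "exp (- p * A) * exp (- p * A) = ?e" by (simp flip: exp_add)
  have sech: "?e / (w \<tau>)\<^sup>2 = 1 - (tanh (m * \<tau> + c))\<^sup>2" for \<tau>
  proof -
    have "(w \<tau>)\<^sup>2 = ?e * (cosh (m * \<tau> + c))\<^sup>2"
      unfolding w_def power_mult_distrib power2_eq_square[of "exp _"] ee ..
    then show ?thesis
      using cosh_square_tanh[of "m * \<tau> + c"] by (simp add: field_simps)
  qed
  have ln: "- ln (w \<tau>) / p = A - ln (cosh (m * \<tau> + c)) / p" for \<tau>
    unfolding w_def using p by (simp add: ln_mult cosh_real_pos field_simps)
  have pos: "w \<tau> > 0" for \<tau> by (simp add: w_def cosh_real_pos)
  have vel: "P * m * ?e / (w \<tau>)\<^sup>2 = P * m * (1 - (tanh (m * \<tau> + c))\<^sup>2)" for P \<tau>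
    unfolding sech[of \<tau>, symmetric] by simp
  have t: "((\<lambda>s. Y + P * tanh (m * s + c)) has_real_derivative P * m * ?e / (w \<tau>)\<^sup>2) (at \<tau>)" for Y P \<tau>
    unfolding vel by (auto intro!: derivative_eq_intros)
  \<comment> \<open>The left side is \<open>m^2 * exp (- 2 * p * A)\<close> by
    \<open>cosh^2 - sinh^2 = 1\<close>; \<open>form_cond\<close> rewrites it through the two
    momenta.\<close>
  have "w \<tau> * w'' \<tau> - (w' \<tau>)\<^sup>2 = p\<^sup>2 * \<alpha>\<^sup>2 / \<epsilon>\<^sup>2 * ((P * m * ?e)\<^sup>2 + (Q * m * ?e)\<^sup>2)" for \<tau>
  proof -
    have "w \<tau> * w'' \<tau> - (w' \<tau>)\<^sup>2 = m\<^sup>2 * ?e"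
      unfolding w_def w'_def w''_def ee[symmetric] using hyperbolic_pythagoras[of "m * \<tau> + c"] by algebra
    also have "\<dots> = p\<^sup>2 / \<epsilon>\<^sup>2 * (\<epsilon>\<^sup>2 / p\<^sup>2) * m\<^sup>2 * ?e" using p eps by simp
    also have "\<dots> = p\<^sup>2 / \<epsilon>\<^sup>2 * (\<alpha>\<^sup>2 * ?e * (P\<^sup>2 + Q\<^sup>2)) * m\<^sup>2 * ?e"
      using form_cond_metric[OF assms] by simp
    also have "\<dots> = p\<^sup>2 * \<alpha>\<^sup>2 / \<epsilon>\<^sup>2 * ((P * m * ?e)\<^sup>2 + (Q * m * ?e)\<^sup>2)"
      unfolding times_divide_eq_left times_divide_eq_right
      by (rule arg_cong[of _ _ "\<lambda>x. x / \<epsilon>\<^sup>2"]) algebra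
    finally show ?thesis .
  qed
  then have "riem_exp g (vector [- ln (w 0) / p, Y + P * tanh (m * 0 + c), Z + Q * tanh (m * 0 + c)])
      (s *\<^sub>R vector [- w' 0 / (p * w 0), P * m * ?e / (w 0)\<^sup>2, Q * m * ?e / (w 0)\<^sup>2])
    = vector [- ln (w s) / p, Y + P * tanh (m * s + c), Z + Q * tanh (m * s + c)]"
    using eps al p
    by (intro riem_exp_sol_metricI[where w' = w' and w'' = w'' and y = "\<lambda>s. Y + P * tanh (m * s + c)"
          and z = "\<lambda>s. Z + Q * tanh (m * s + c)"] t pos)
      (auto simp: w_def[abs_def] w'_def[abs_def] w''_def intro!: derivative_eq_intros)
  moreover have "(vector [- w' 0 / (p * w 0), P * m * ?e / (w 0)\<^sup>2, Q * m * ?e / (w 0)\<^sup>2] :: real^3)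
      = m *\<^sub>R vector [- tanh c / p, P * (1 - (tanh c)\<^sup>2), Q * (1 - (tanh c)\<^sup>2)]"
    unfolding vel by (simp add: vec_eq_iff forall_3 w'_def w_def tanh_def[of c])
  ultimately show ?thesis
    unfolding ln by (simp add: normal_form_def)
qed

text \<open>The case of zero momenta: \<open>w\<close> is a pure exponential, for which
  \<open>w * w''\<close> equals the square of \<open>w'\<close>.\<close>

lemma riem_exp_vertical:
  "riem_exp g q (s *\<^sub>R vector [b, 0, 0]) = vector [q $ 1 + s * b, q $ 2, q $ 3]"
proof -
  define w where "w \<tau> = exp (- p * (q $ 1 + \<tau> * b))" for \<tau>
  have ln: "- ln (w \<tau>) / p = q $ 1 + \<tau> * b" for \<tau>
    using p by (simp add: w_def)
  have "riem_exp g (vector [- ln (w 0) / p, q $ 2, q $ 3])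
      (s *\<^sub>R vector [- (- p * b * w 0) / (p * w 0), 0 / (w 0)\<^sup>2, 0 / (w 0)\<^sup>2])
    = vector [- ln (w s) / p, q $ 2, q $ 3]"
    using eps al p
    by (intro riem_exp_sol_metricI[where w' = "\<lambda>\<tau>. - p * b * w \<tau>" and w'' = "\<lambda>\<tau>. - p * b * (- p * b * w \<tau>)"
          and y = "\<lambda>\<tau>. q $ 2" and z = "\<lambda>\<tau>. q $ 3"])
      (auto simp: w_def[abs_def] power2_eq_square intro!: derivative_eq_intros)
  moreover have "- (- p * b * w 0) / (p * w 0) = b" using p by (simp add: w_def)
  moreover have "vector [q $ 1 + 0 * b, q $ 2, q $ 3] = q" by (simp add: vec_eq_iff forall_3)
  ultimately show ?thesis unfolding ln by simp
qed

text \<open>The rate \<open>L\<close> may still vary with \<open>t\<close>, because its constancy is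
  to be deduced from the second formula.\<close>

lemma normal_form_surface:
  assumes T: "open T" "t \<in> T" and S: "open S" "s \<in> S"
    and sm: "smooth_on T A" "smooth_on T P" "smooth_on T Q" "smooth_on T Y" "smooth_on T Z"
      "smooth_on T L" "smooth_on T c"
    and cond: "\<And>t. t \<in> T \<Longrightarrow> form_cond (A t) (P t) (Q t)"
    and F: "\<And>t s. t \<in> T \<Longrightarrow> s \<in> S \<Longrightarrow> F (t, s) = normal_form (A t) (P t) (Q t) (Y t) (Z t) (L t * s + c t)"
  shows "surf_s F (t, s) = L t *\<^sub>R vector [- tanh (L t * s + c t) / p,
      P t * (1 - (tanh (L t * s + c t))\<^sup>2), Q t * (1 - (tanh (L t * s + c t))\<^sup>2)]"
    and "g (F (t, s)) (surf_t F (t, s)) (surf_s F (t, s)) = L t * (\<epsilon>\<^sup>2 / p\<^sup>2 * (deriv L t * s + deriv c t)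
      + \<alpha>\<^sup>2 * exp (- 2 * p * A t) * (P t * deriv Y t + Q t * deriv Z t))"
proof -
  show s: "surf_s F (t, s) = L t *\<^sub>R vector [- tanh (L t * s + c t) / p,
      P t * (1 - (tanh (L t * s + c t))\<^sup>2), Q t * (1 - (tanh (L t * s + c t))\<^sup>2)]"
    by (rule surf_s_eq[OF S F[OF T(2)] normal_form_deriv_s])
  note d = sm[THEN smooth_on_DERIV, OF T(2)]
  have "((\<lambda>t. L t * s + c t) has_real_derivative deriv L t * s + deriv c t) (at t)"
    by (auto intro!: derivative_eq_intros d)
  from surf_t_eq[OF T F[OF _ S(2)] normal_form_deriv[OF d(1-5) this refl]]
  have t: "surf_t F (t, s) = vector [deriv A t - tanh (L t * s + c t) * (deriv L t * s + deriv c t) / p,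
    deriv Y t + deriv P t * tanh (L t * s + c t)
      + P t * (1 - (tanh (L t * s + c t))\<^sup>2) * (deriv L t * s + deriv c t),
    deriv Z t + deriv Q t * tanh (L t * s + c t)
      + Q t * (1 - (tanh (L t * s + c t))\<^sup>2) * (deriv L t * s + deriv c t)]" .
  \<comment> \<open>Both sides of \<open>form_cond\<close> are differentiated in \<open>t\<close>
    and compared, which supplies the second assumption of
    \<open>metric_normal_form_ts\<close>.\<close>
  have "((\<lambda>t. (P t)\<^sup>2 + (Q t)\<^sup>2) has_real_derivative 2 * P t * deriv P t + 2 * Q t * deriv Q t) (at t)"
    by (auto intro!: derivative_eq_intros d)
  moreover have "((\<lambda>t. (\<epsilon> / (p * \<alpha>))\<^sup>2 * exp (2 * p * A t)) has_real_derivative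
      (\<epsilon> / (p * \<alpha>))\<^sup>2 * (exp (2 * p * A t) * (2 * p * deriv A t))) (at t)"
    by (auto intro!: derivative_eq_intros d)
  then have "((\<lambda>t. (P t)\<^sup>2 + (Q t)\<^sup>2) has_real_derivative
      (\<epsilon> / (p * \<alpha>))\<^sup>2 * (exp (2 * p * A t) * (2 * p * deriv A t))) (at t)"
    by (rule has_field_derivative_transform_within_open[OF _ T]) (use cond in \<open>simp add: form_cond_def\<close>)
  ultimately have "2 * P t * deriv P t + 2 * Q t * deriv Q t =
      (\<epsilon> / (p * \<alpha>))\<^sup>2 * (exp (2 * p * A t) * (2 * p * deriv A t))"
    by (rule DERIV_unique)
  also have "\<dots> = 2 * (p * deriv A t * ((P t)\<^sup>2 + (Q t)\<^sup>2))"
    using cond[OF T(2)] by (simp add: form_cond_def)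
  finally have "P t * deriv P t + Q t * deriv Q t = p * deriv A t * ((P t)\<^sup>2 + (Q t)\<^sup>2)" by simp
  from metric_normal_form_ts[OF cond[OF T(2)] this]
  show "g (F (t, s)) (surf_t F (t, s)) (surf_s F (t, s)) = L t * (\<epsilon>\<^sup>2 / p\<^sup>2 * (deriv L t * s + deriv c t)
      + \<alpha>\<^sup>2 * exp (- 2 * p * A t) * (P t * deriv Y t + Q t * deriv Z t))"
    unfolding s t F[OF T(2) S(2)] .
qed

end

lemma tanh_artanh_real:
  fixes x :: real
  assumes "\<bar>x\<bar> < 1"
  shows "tanh (artanh x) = x"
proof -
  have e: "exp (- 2 * artanh x) = (1 - x) / (1 + x)"
    using assms by (simp add: artanh_def exp_minus abs_less_iff)
  show ?thesis
    using assms unfolding tanh_real_altdef e by (simp add: field_simps abs_less_iff)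
qed

context sol_params
begin

section \<open>The two forms are orthogonal ruled surfaces\<close>

lemma metric_zero: "g q 0 0 = 0"
  by (simp add: sol_metric_eq)

text \<open>With a constant rate \<open>m\<close> the coefficient of \<open>s\<close> in the mixed
  product drops out, and \<open>orth\<close> says that the remaining term is zero.\<close>

lemma orthogonal_normal_form_surface:
  assumes T: "open T" and S: "open S"
    and sm: "smooth_on T A" "smooth_on T P" "smooth_on T Q" "smooth_on T Y" "smooth_on T Z" "smooth_on T c"
    and m: "m \<noteq> 0"
    and cond: "\<And>t. t \<in> T \<Longrightarrow> form_cond (A t) (P t) (Q t)"
    and orth: "\<And>t. t \<in> T \<Longrightarrow>
      \<epsilon>\<^sup>2 / p\<^sup>2 * deriv c t + \<alpha>\<^sup>2 * exp (- 2 * p * A t) * (P t * deriv Y t + Q t * deriv Z t) = 0"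
    and F: "\<And>t s. t \<in> T \<Longrightarrow> s \<in> S \<Longrightarrow> F (t, s) = normal_form (A t) (P t) (Q t) (Y t) (Z t) (m * s + c t)"
  shows "orthogonal_ruled_surface g T S F"
  unfolding orthogonal_ruled_surface_def ruled_surface_def
proof (intro conjI ballI)
  \<comment> \<open>Base curve and ruling field are the normal form and its velocity at
    \<open>s = 0\<close>. They are taken from the formula and not from \<open>F\<close>, because
    \<open>S\<close> may miss \<open>0\<close>.\<close>
  define \<gamma> where "\<gamma> t = normal_form (A t) (P t) (Q t) (Y t) (Z t) (c t)" for t
  define X where "X t = m *\<^sub>R (vector [- tanh (c t) / p, P t * (1 - (tanh (c t))\<^sup>2),
    Q t * (1 - (tanh (c t))\<^sup>2)] :: real^3)" for t
  have TS: "open (T \<times> S)" by (rule open_Times[OF T S])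
  show "smooth_on (T \<times> S) F"
  proof (rule smooth_on_cong[OF TS])
    note fst = sm[THEN smooth_on_compose_fst[OF T S]]
    have snd: "smooth_on (T \<times> S) (\<lambda>x. snd x)"
      using smooth_on_linear[OF TS bounded_linear_snd] .
    show "smooth_on (T \<times> S) (\<lambda>x. normal_form (A (fst x)) (P (fst x)) (Q (fst x)) (Y (fst x)) (Z (fst x))
        (m * snd x + c (fst x)))"
      unfolding normal_form_def
      by (intro smooth_on_vector_3 smooth_on_add smooth_on_diff smooth_on_mult smooth_on_divide smooth_on_ln
          smooth_on_cosh smooth_on_tanh smooth_on_const fst snd TS cosh_real_pos p)
  qed (auto simp: F)
  show "\<exists>\<gamma> X. smooth_on T \<gamma> \<and> smooth_on T X \<and> (\<forall>t\<in>T. X t \<noteq> 0) \<and>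
      (\<forall>t\<in>T. \<forall>s\<in>S. F (t, s) = riem_exp g (\<gamma> t) (s *\<^sub>R X t))"
  proof (intro exI conjI ballI)
    show "smooth_on T \<gamma>"
      unfolding \<gamma>_def[abs_def] normal_form_def
      by (intro smooth_on_vector_3 smooth_on_add smooth_on_diff smooth_on_mult smooth_on_divide smooth_on_ln
          smooth_on_cosh smooth_on_tanh smooth_on_const sm T cosh_real_pos p)
    show "smooth_on T X"
      unfolding X_def[abs_def]
      by (rule smooth_on_linear_compose[OF T bounded_linear_scaleR_right],
          intro smooth_on_vector_3 smooth_on_diff smooth_on_mult smooth_on_divide smooth_on_minus
          smooth_on_tanh smooth_on_power smooth_on_const sm T p)
    show "X t \<noteq> 0" if "t \<in> T" for t
    proof
      assume "X t = 0"
      moreover have "g (\<gamma> t) (X t) (X t) = \<epsilon>\<^sup>2 * m\<^sup>2 / p\<^sup>2"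
        unfolding \<gamma>_def X_def by (rule metric_normal_form_ss[OF cond[OF that]])
      ultimately show False using m p eps by (simp add: metric_zero)
    qed
    show "F (t, s) = riem_exp g (\<gamma> t) (s *\<^sub>R X t)" if "t \<in> T" "s \<in> S" for t s
      unfolding \<gamma>_def X_def riem_exp_normal_form[OF cond[OF that(1)]] F[OF that] ..
  qed
  show "g (F (t, s)) (surf_t F (t, s)) (surf_s F (t, s)) = 0" if "t \<in> T" "s \<in> S" for t s
    using normal_form_surface(2)[OF T that(1) S that(2) sm(1-5) smooth_on_const[OF T] sm(6) cond F]
      orth[OF that(1)] by simp
qed

lemma sol_form1_orthogonal:
  assumes T: "T = einterval t1 t2" and S: "open S" and F: "sol_form1 p \<epsilon> \<alpha> T S F"
  shows "orthogonal_ruled_surface g T S F"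
proof -
  have oT: "open T" by (simp add: T)
  obtain c1 \<theta> A1 b1 t0 y0 z0 where t0: "t0 \<in> T" and
    sm: "smooth_on T c1" "smooth_on T \<theta>" "smooth_on T A1" "smooth_on T b1" and
    F: "\<And>t s. t \<in> T \<Longrightarrow> s \<in> S \<Longrightarrow> F (t, s) = vector
          [A1 t - 1 / p * ln (cosh (p / \<epsilon> * s + c1 t)),
           y0 + (LBINT u=t0..t. exp (p * A1 u) *
                   (- (\<epsilon> / (p * \<alpha>)) * deriv c1 u * cos (A1 u + \<theta> u)
                    + b1 u / \<alpha> * sin (A1 u + \<theta> u)))
              + \<epsilon> / (p * \<alpha>) * exp (p * A1 t) * cos (A1 t + \<theta> t) * tanh (p / \<epsilon> * s + c1 t),
           z0 - (LBINT u=t0..t. exp (p * A1 u) *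
                   (\<epsilon> / (p * \<alpha>) * deriv c1 u * sin (A1 u + \<theta> u)
                    + b1 u / \<alpha> * cos (A1 u + \<theta> u)))
              + \<epsilon> / (p * \<alpha>) * exp (p * A1 t) * sin (A1 t + \<theta> t) * tanh (p / \<epsilon> * s + c1 t)]"
    using F unfolding sol_form1_def by blast
  define f where "f u = exp (p * A1 u) * (- (\<epsilon> / (p * \<alpha>)) * deriv c1 u * cos (A1 u + \<theta> u)
      + b1 u / \<alpha> * sin (A1 u + \<theta> u))" for u
  define h where "h u = exp (p * A1 u) * (\<epsilon> / (p * \<alpha>) * deriv c1 u * sin (A1 u + \<theta> u)
      + b1 u / \<alpha> * cos (A1 u + \<theta> u))" for u
  define P where "P t = \<epsilon> / (p * \<alpha>) * exp (p * A1 t) * cos (A1 t + \<theta> t)" for t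
  define Q where "Q t = \<epsilon> / (p * \<alpha>) * exp (p * A1 t) * sin (A1 t + \<theta> t)" for t
  define Y where "Y t = y0 + (LBINT u=t0..t. f u)" for t
  define Z where "Z t = z0 - (LBINT u=t0..t. h u)" for t
  have al0: "\<alpha> \<noteq> 0" using al by simp
  have fh: "smooth_on T f" "smooth_on T h"
    unfolding f_def[abs_def] h_def[abs_def]
    by (intro smooth_on_add smooth_on_mult smooth_on_divide smooth_on_exp smooth_on_cos smooth_on_sin
        smooth_on_const smooth_on_real_deriv sm oT al0)+
  have PQ: "smooth_on T P" "smooth_on T Q"
    unfolding P_def[abs_def] Q_def[abs_def]
    by (intro smooth_on_add smooth_on_mult smooth_on_exp smooth_on_cos smooth_on_sin
        smooth_on_const sm oT)+
  note f_int = smooth_on_integral[OF fh(1)[unfolded T] t0[unfolded T], folded T]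
    and h_int = smooth_on_integral[OF fh(2)[unfolded T] t0[unfolded T], folded T]
  have YZ: "smooth_on T Y" "smooth_on T Z"
    unfolding Y_def[abs_def] Z_def[abs_def]
    by (intro smooth_on_add smooth_on_diff smooth_on_const f_int(2) h_int(2) oT)+
  have dY: "deriv Y t = f t" if "t \<in> T" for t
    using DERIV_add[OF DERIV_const f_int(1)[OF that]] by (intro DERIV_imp_deriv) (simp add: Y_def[abs_def])
  have dZ: "deriv Z t = - h t" if "t \<in> T" for t
    using DERIV_diff[OF DERIV_const h_int(1)[OF that]] by (intro DERIV_imp_deriv) (simp add: Z_def[abs_def])
  show ?thesis
  proof (rule orthogonal_normal_form_surface[OF oT S sm(3) PQ YZ sm(1)])
    show "p / \<epsilon> \<noteq> 0" using p eps by simp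
    show "form_cond (A1 t) (P t) (Q t)" if "t \<in> T" for t
    proof -
      have "exp (2 * p * A1 t) = exp (p * A1 t) * exp (p * A1 t)" by (simp flip: exp_add)
      then show ?thesis
        unfolding form_cond_def P_def Q_def using sin_cos_squared_add2[of "A1 t + \<theta> t"] by algebra
    qed
    show "F (t, s) = normal_form (A1 t) (P t) (Q t) (Y t) (Z t) (p / \<epsilon> * s + c1 t)"
      if "t \<in> T" "s \<in> S" for t s
      unfolding F[OF that] normal_form_def Y_def Z_def f_def h_def P_def Q_def by simp
    show "\<epsilon>\<^sup>2 / p\<^sup>2 * deriv c1 t + \<alpha>\<^sup>2 * exp (- 2 * p * A1 t) * (P t * deriv Y t + Q t * deriv Z t) = 0"
      if "t \<in> T" for t
    proof -
      define k where "k = \<epsilon> / (p * \<alpha>)"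
      have "exp (- 2 * p * A1 t) * (exp (p * A1 t) * exp (p * A1 t)) = 1" by (simp flip: exp_add)
      moreover have "\<epsilon>\<^sup>2 / p\<^sup>2 = \<alpha>\<^sup>2 * k\<^sup>2" using al by (simp add: k_def power_divide power_mult_distrib)
      \<comment> \<open>The function \<open>b1\<close> cancels, since it multiplies a vector
        orthogonal to \<open>(P, Q)\<close>; the two terms with \<open>deriv c1\<close> compensate
        each other.\<close>
      ultimately show ?thesis
        unfolding dY[OF that] dZ[OF that] f_def h_def P_def Q_def k_def[symmetric]
        using sin_cos_squared_add2[of "A1 t + \<theta> t"] by algebra
    qed
  qed
qed

lemma sol_form2_orthogonal:
  assumes T: "open T" and S: "open S" and F: "sol_form2 \<epsilon> T S F"
  shows "orthogonal_ruled_surface g T S F"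
proof -
  obtain R A2 A3 where sm: "smooth_on T A2" "smooth_on T A3" and
    F: "\<And>t s. t \<in> T \<Longrightarrow> s \<in> S \<Longrightarrow> F (t, s) = vector [R + s / \<epsilon>, A2 t, A3 t]"
    using F unfolding sol_form2_def by blast
  have TS: "open (T \<times> S)" by (rule open_Times[OF T S])
  have eps0: "\<epsilon> \<noteq> 0" using eps by simp
  show ?thesis
    unfolding orthogonal_ruled_surface_def ruled_surface_def
  proof (intro conjI ballI)
    show "smooth_on (T \<times> S) F"
    proof (rule smooth_on_cong[OF TS])
      note fst = sm[THEN smooth_on_compose_fst[OF T S]]
      have snd: "smooth_on (T \<times> S) (\<lambda>x. snd x)"
        using smooth_on_linear[OF TS bounded_linear_snd] .
      show "smooth_on (T \<times> S) (\<lambda>x. vector [R + snd x / \<epsilon>, A2 (fst x), A3 (fst x)] :: real^3)"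
        by (intro smooth_on_vector_3 smooth_on_add smooth_on_divide smooth_on_const fst snd TS eps0)
    qed (auto simp: F)
    show "\<exists>\<gamma> X. smooth_on T \<gamma> \<and> smooth_on T X \<and> (\<forall>t\<in>T. X t \<noteq> 0) \<and>
        (\<forall>t\<in>T. \<forall>s\<in>S. F (t, s) = riem_exp g (\<gamma> t) (s *\<^sub>R X t))"
    proof (intro exI conjI ballI)
      show "smooth_on T (\<lambda>t. vector [R, A2 t, A3 t] :: real^3)"
        by (intro smooth_on_vector_3 smooth_on_const sm T)
      show "smooth_on T (\<lambda>t. vector [1 / \<epsilon>, 0, 0] :: real^3)"
        by (intro smooth_on_const T)
      show "vector [1 / \<epsilon>, 0, 0] \<noteq> (0 :: real^3)"
        using eps by (simp add: vec_eq_iff forall_3)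
      show "F (t, s) = riem_exp g (vector [R, A2 t, A3 t]) (s *\<^sub>R vector [1 / \<epsilon>, 0, 0])"
        if "t \<in> T" "s \<in> S" for t s
        unfolding riem_exp_vertical F[OF that] by simp
    qed
    show "g (F (t, s)) (surf_t F (t, s)) (surf_s F (t, s)) = 0" if "t \<in> T" "s \<in> S" for t s
    proof -
      have "surf_s F (t, s) = vector [1 / \<epsilon>, 0, 0]"
        by (rule surf_s_eq[where G = "\<lambda>s. vector [R + s / \<epsilon>, A2 t, A3 t]", OF S that(2) F[OF that(1)]],
            assumption, rule has_vector_derivative_vector_3)
          (use eps in \<open>auto intro!: derivative_eq_intros\<close>)
      moreover have "surf_t F (t, s) = vector [0, deriv A2 t, deriv A3 t]"
        by (rule surf_t_eq[where G = "\<lambda>t. vector [R + s / \<epsilon>, A2 t, A3 t]", OF T that(1) F[OF _ that(2)]],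
            assumption, rule has_vector_derivative_vector_3)
          (use sm that in \<open>auto intro!: smooth_on_DERIV\<close>)
      ultimately show ?thesis by (simp add: sol_metric_eq)
    qed
  qed
qed

section \<open>Normal form data from an initial point and velocity\<close>

definition speed :: "real^3 \<Rightarrow> real^3 \<Rightarrow> real" where
  "speed q u = sol_norm p \<epsilon> \<alpha> q u"

text \<open>The data of the normal form of the geodesic with initial point \<open>q\<close> and initial velocity \<open>u\<close>;
  they are meaningful only if \<open>u\<close> is not a multiple of \<open>e\<^sub>1\<close>.\<close>
definition nf_rate :: "real^3 \<Rightarrow> real^3 \<Rightarrow> real" where
  "nf_rate q u = p * speed q u / \<epsilon>"

definition nf_shift :: "real^3 \<Rightarrow> real^3 \<Rightarrow> real" where
  "nf_shift q u = - artanh (\<epsilon> * u $ 1 / speed q u)"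

definition nf_A :: "real^3 \<Rightarrow> real^3 \<Rightarrow> real" where
  "nf_A q u = q $ 1 + ln (cosh (nf_shift q u)) / p"

definition nf_coeff :: "3 \<Rightarrow> real^3 \<Rightarrow> real^3 \<Rightarrow> real" where
  "nf_coeff i q u = u $ i * (cosh (nf_shift q u))\<^sup>2 / nf_rate q u"

definition nf_base :: "3 \<Rightarrow> real^3 \<Rightarrow> real^3 \<Rightarrow> real" where
  "nf_base i q u = q $ i - nf_coeff i q u * tanh (nf_shift q u)"

lemma speed_square: "(speed q u)\<^sup>2 = g q u u"
  by (cases "u = 0") (simp_all add: speed_def sol_norm_def metric_zero metric_pos less_imp_le)

lemma speed_pos: "u \<noteq> 0 \<Longrightarrow> speed q u > 0"
  by (simp add: speed_def sol_norm_def metric_pos)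

text \<open>\<open>\<epsilon> * u $ 1\<close> is the component of \<open>u\<close> along the unit
  vector in direction \<open>e1\<close>, and a nonzero horizontal part makes it smaller than the
  speed. This puts the argument of \<open>artanh\<close> in \<open>nf_shift\<close> into its
  domain.\<close>

lemma slope_less_1:
  assumes "u $ 2 \<noteq> 0 \<or> u $ 3 \<noteq> 0"
  shows "\<bar>\<epsilon> * u $ 1 / speed q u\<bar> < 1"
proof -
  have "u \<noteq> 0" using assms by auto
  have "(u $ 2)\<^sup>2 + (u $ 3)\<^sup>2 > 0" using assms by (simp add: sum_power2_gt_zero_iff)
  then have "(\<epsilon> * u $ 1)\<^sup>2 < (speed q u)\<^sup>2"
    unfolding speed_square sol_metric_eq using al by (simp add: power2_eq_square)
  then have "\<bar>\<epsilon> * u $ 1\<bar> < \<bar>speed q u\<bar>"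
    using abs_le_square_iff[of "speed q u" "\<epsilon> * u $ 1"] by linarith
  moreover have "\<bar>speed q u\<bar> > 0" using speed_pos[OF \<open>u \<noteq> 0\<close>, of q] by linarith
  ultimately show ?thesis unfolding abs_divide using divide_less_eq_1_pos by blast
qed

text \<open>The data solve the equations that the normal form at parameter \<open>c\<close> is
  \<open>q\<close> and its velocity is \<open>u\<close>. The first velocity entry fixes
  \<open>tanh c\<close>, the other two fix \<open>P\<close> and \<open>Q\<close>, and the point
  fixes \<open>A\<close>, \<open>Y\<close> and \<open>Z\<close>.\<close>

lemma initial_normal_form:
  fixes q u :: "real^3"
  assumes "u $ 2 \<noteq> 0 \<or> u $ 3 \<noteq> 0"
  defines "c \<equiv> nf_shift q u" and "L \<equiv> nf_rate q u" and "A \<equiv> nf_A q u"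
    and "P \<equiv> nf_coeff 2 q u" and "Q \<equiv> nf_coeff 3 q u" and "Y \<equiv> nf_base 2 q u" and "Z \<equiv> nf_base 3 q u"
  shows "form_cond A P Q"
    and "riem_exp g q (s *\<^sub>R u) = normal_form A P Q Y Z (L * s + c)"
proof -
  have u: "u \<noteq> 0" using assms(1) by auto
  define v where "v = speed q u"
  have v: "v > 0" unfolding v_def by (rule speed_pos[OF u])
  have L: "L = p * v / \<epsilon>" by (simp add: L_def nf_rate_def v_def)
  have L0: "L \<noteq> 0" using v p eps by (simp add: L)
  have th: "tanh c = - (\<epsilon> * u $ 1 / v)"
    unfolding c_def nf_shift_def v_def by (simp add: tanh_artanh_real[OF slope_less_1[OF assms(1)]])
  define K where "K = (cosh c)\<^sup>2"
  have K: "K * (1 - (tanh c)\<^sup>2) = 1" unfolding K_def by (rule cosh_square_tanh)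
  have PQ: "P * L = u $ 2 * K" "Q * L = u $ 3 * K"
    using L0 by (simp_all add: P_def Q_def nf_coeff_def c_def[symmetric] L_def[symmetric] K_def)
  have P: "P * (1 - (tanh c)\<^sup>2) * L = u $ 2" "Q * (1 - (tanh c)\<^sup>2) * L = u $ 3"
    using K PQ by algebra+
  have "p * A = p * q $ 1 + ln (cosh c)"
    using p by (simp add: A_def nf_A_def c_def field_simps)
  then have A: "2 * p * A = 2 * p * q $ 1 + (ln (cosh c) + ln (cosh c))" by simp
  have eA: "exp (2 * p * A) = exp (2 * p * q $ 1) * K"
    unfolding A exp_add by (simp add: K_def power2_eq_square)
  define N where "N = \<alpha>\<^sup>2 * exp (- 2 * p * q $ 1)"
  have N: "N * exp (2 * p * q $ 1) = \<alpha>\<^sup>2" by (simp add: N_def mult.assoc flip: exp_add)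
  have E: "\<epsilon>\<^sup>2 * (u $ 1)\<^sup>2 + N * ((u $ 2)\<^sup>2 + (u $ 3)\<^sup>2) = v\<^sup>2"
    unfolding v_def speed_square sol_metric_eq N_def by (simp add: power2_eq_square)
  have "(tanh c)\<^sup>2 * v\<^sup>2 = \<epsilon>\<^sup>2 * (u $ 1)\<^sup>2"
    unfolding th using v by (simp add: power_divide power_mult_distrib)
  with E have "N * ((u $ 2)\<^sup>2 + (u $ 3)\<^sup>2) = (1 - (tanh c)\<^sup>2) * v\<^sup>2" by (simp add: algebra_simps)
  with K have NK: "N * ((u $ 2)\<^sup>2 + (u $ 3)\<^sup>2) * K = v\<^sup>2" by algebra
  show cond: "form_cond A P Q"
  proof -
    have Lv: "L * \<epsilon> = p * v" using eps by (simp add: L)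
    have "\<alpha>\<^sup>2 * p\<^sup>2 * v\<^sup>2 * (P\<^sup>2 + Q\<^sup>2) = v\<^sup>2 * \<epsilon>\<^sup>2 * (exp (2 * p * q $ 1) * K)"
      using PQ NK Lv N by algebra
    then have "\<alpha>\<^sup>2 * p\<^sup>2 * (P\<^sup>2 + Q\<^sup>2) = \<epsilon>\<^sup>2 * (exp (2 * p * q $ 1) * K)"
      using v by simp
    then show ?thesis
      unfolding form_cond_def eA using al p by (simp add: power_divide power_mult_distrib field_simps)
  qed
  have q: "q = normal_form A P Q Y Z c"
    by (simp add: vec_eq_iff forall_3 normal_form_def Y_def Z_def nf_base_def A_def nf_A_def P_def Q_def c_def)
  have "L * (- tanh c / p) = u $ 1" unfolding th L using v p eps by simp
  then have X: "u = L *\<^sub>R vector [- tanh c / p, P * (1 - (tanh c)\<^sup>2), Q * (1 - (tanh c)\<^sup>2)]"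
    using P by (simp add: vec_eq_iff forall_3 mult.commute)
  show "riem_exp g q (s *\<^sub>R u) = normal_form A P Q Y Z (L * s + c)"
    by (subst (1) q, subst X, rule riem_exp_normal_form[OF cond])
qed

end

section \<open>Classification of orthogonal ruled surfaces\<close>

text \<open>Otherwise some nonempty open \<open>W\<close> inside \<open>T\<close> would lie in the
  frontier. The open set \<open>T - V\<close> misses \<open>closure V\<close>, so \<open>W\<close>
  would lie in \<open>V\<close> and hence in its interior, which is disjoint from the
  frontier.\<close>

lemma subset_closure_diff_frontier:
  assumes T: "open T" and V: "open (T - V)"
  shows "T \<subseteq> closure (T - frontier V)"
proof
  fix t assume t: "t \<in> T"
  show "t \<in> closure (T - frontier V)"
  proof (rule ccontr)
    assume t': "t \<notin> closure (T - frontier V)"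
    define W where "W = T - closure (T - frontier V)"
    have W: "open W" "t \<in> W" unfolding W_def using T t t' by (auto intro: open_Diff)
    have WF: "W \<subseteq> frontier V" unfolding W_def using closure_subset[of "T - frontier V"] by blast
    have "(T - V) \<inter> closure V = {}" using open_Int_closure_eq_empty[OF V] by blast
    with WF have "W \<subseteq> V" unfolding W_def frontier_def by blast
    with W have "t \<in> interior V" by (auto intro: interiorI)
    with WF W show False unfolding frontier_def by blast
  qed
qed

lemma smooth_zero_deriv_const:
  fixes f :: "real \<Rightarrow> real"
  assumes f: "smooth_on (einterval a b) f" and 0: "\<And>t. t \<in> einterval a b \<Longrightarrow> deriv f t = 0"
    and "t \<in> einterval a b" "t' \<in> einterval a b"
  shows "f t = f t'"
proof -
  have "(f has_real_derivative 0) (at x within einterval a b)" if "x \<in> einterval a b" for x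
    using smooth_on_DERIV[OF f that] 0[OF that] by (simp add: has_field_derivative_at_within)
  then obtain c where "\<forall>x\<in>einterval a b. f x = c"
    using has_field_derivative_zero_constant[OF convex_einterval, of a b f] by blast
  with assms(3,4) show ?thesis by simp
qed

section \<open>Orthogonality along vertical and non-vertical rulings\<close>

locale orthogonal_ruling = sol_params +
  fixes t1 t2 :: ereal and T S :: "real set" and F :: "real \<times> real \<Rightarrow> real^3" and \<gamma> X :: "real \<Rightarrow> real^3"
  assumes T: "T = einterval t1 t2" and T_nonempty: "T \<noteq> {}" and S: "open S" "S \<noteq> {}"
    and \<gamma>: "smooth_on T \<gamma>" and X: "smooth_on T X" and X_nonzero: "\<And>t. t \<in> T \<Longrightarrow> X t \<noteq> 0"
    and F: "\<And>t s. t \<in> T \<Longrightarrow> s \<in> S \<Longrightarrow> F (t, s) = riem_exp g (\<gamma> t) (s *\<^sub>R X t)"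
    and orth: "\<And>t s. t \<in> T \<Longrightarrow> s \<in> S \<Longrightarrow> g (F (t, s)) (surf_t F (t, s)) (surf_s F (t, s)) = 0"
begin

lemma open_T: "open T"
  by (simp add: T)

text \<open>Verticality is read off the initial velocity; \<open>vertical_rulings_eq\<close> shows
  that this is the set defined through \<open>surf_s\<close>.\<close>

definition V :: "real set" where
  "V = {t \<in> T. X t $ 2 = 0 \<and> X t $ 3 = 0}"

definition v :: "real \<Rightarrow> real" where
  "v t = speed (\<gamma> t) (X t)"

lemma v_pos: "t \<in> T \<Longrightarrow> v t > 0"
  unfolding v_def by (rule speed_pos[OF X_nonzero])

lemma smooth_v: "smooth_on T v"
proof -
  have "smooth_on T (\<lambda>t. g (\<gamma> t) (X t) (X t))"
    unfolding sol_metric_eq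
    by (intro smooth_on_add smooth_on_mult smooth_on_exp smooth_on_const smooth_on_vec_nth \<gamma> X open_T)
  then show ?thesis
    unfolding v_def[abs_def] speed_def sol_norm_def
    by (intro smooth_on_sqrt open_T metric_pos X_nonzero)
qed

lemma open_non_vertical: "open (T - V)"
proof -
  have "continuous_on T (\<lambda>t. (X t $ 2)\<^sup>2 + (X t $ 3)\<^sup>2)"
    by (intro smooth_on_imp_continuous_on smooth_on_add smooth_on_power smooth_on_vec_nth X open_T)
  then have "open (T \<inter> (\<lambda>t. (X t $ 2)\<^sup>2 + (X t $ 3)\<^sup>2) -` (- {0}))"
    by (rule continuous_open_preimage) (auto simp: open_T)
  moreover have "T \<inter> (\<lambda>t. (X t $ 2)\<^sup>2 + (X t $ 3)\<^sup>2) -` (- {0}) = T - V"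
    by (auto simp: V_def sum_power2_eq_zero_iff)
  ultimately show ?thesis by simp
qed

definition "L t = nf_rate (\<gamma> t) (X t)"
definition "c t = nf_shift (\<gamma> t) (X t)"
definition "A t = nf_A (\<gamma> t) (X t)"
definition "P t = nf_coeff 2 (\<gamma> t) (X t)"
definition "Q t = nf_coeff 3 (\<gamma> t) (X t)"
definition "Y t = nf_base 2 (\<gamma> t) (X t)"
definition "Z t = nf_base 3 (\<gamma> t) (X t)"

lemma L_eq: "L t = p * v t / \<epsilon>"
  by (simp add: L_def nf_rate_def v_def)

lemma L_nonzero: "t \<in> T \<Longrightarrow> L t \<noteq> 0"
  using v_pos[of t] p eps by (simp add: L_eq)

text \<open>Off \<open>V\<close> the speed is nonzero and the slope is less than 1 in absolute
  value, so neither a zero denominator nor the boundary of the domain of \<open>artanh\<close> is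
  met.\<close>

lemma smooth_normal_form_data:
  "smooth_on (T - V) L" "smooth_on (T - V) c" "smooth_on (T - V) A" "smooth_on (T - V) P"
  "smooth_on (T - V) Q" "smooth_on (T - V) Y" "smooth_on (T - V) Z"
proof -
  note O = open_non_vertical
  have sub: "T - V \<subseteq> T" by blast
  note sm = smooth_on_vec_nth[OF O smooth_on_subset[OF \<gamma> sub]] smooth_on_vec_nth[OF O smooth_on_subset[OF X sub]]
  have v: "smooth_on (T - V) (\<lambda>t. speed (\<gamma> t) (X t))"
    using smooth_on_subset[OF smooth_v sub] by (simp add: v_def[abs_def])
  have v0: "speed (\<gamma> t) (X t) \<noteq> 0" if "t \<in> T - V" for t
    using v_pos[of t] that by (auto simp: v_def)
  have slope: "\<bar>\<epsilon> * X t $ 1 / speed (\<gamma> t) (X t)\<bar> < 1" if "t \<in> T - V" for t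
    using that by (intro slope_less_1) (auto simp: V_def)
  show L: "smooth_on (T - V) L"
    unfolding L_def[abs_def] nf_rate_def using eps
    by (intro smooth_on_divide smooth_on_mult smooth_on_const v O) auto
  show c: "smooth_on (T - V) c"
    unfolding c_def[abs_def] nf_shift_def
    by (intro smooth_on_minus smooth_on_artanh smooth_on_divide smooth_on_mult smooth_on_const sm v O v0 slope)
  show A: "smooth_on (T - V) A"
    unfolding A_def[abs_def] nf_A_def c_def[symmetric]
    by (intro smooth_on_add smooth_on_divide smooth_on_ln smooth_on_cosh smooth_on_const sm c O p cosh_real_pos)
  have coeff: "smooth_on (T - V) (\<lambda>t. nf_coeff i (\<gamma> t) (X t))" for i
    unfolding nf_coeff_def c_def[symmetric] L_def[symmetric]
    by (intro smooth_on_divide smooth_on_mult smooth_on_power smooth_on_cosh sm c L O L_nonzero) auto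
  show "smooth_on (T - V) P" "smooth_on (T - V) Q"
    unfolding P_def[abs_def] Q_def[abs_def] by (rule coeff)+
  show "smooth_on (T - V) Y" "smooth_on (T - V) Z"
    unfolding Y_def[abs_def] Z_def[abs_def] nf_base_def c_def[symmetric]
    by (intro smooth_on_diff smooth_on_mult smooth_on_tanh sm c coeff O)+
qed

lemma
  assumes "t \<in> T - V"
  shows form_cond: "form_cond (A t) (P t) (Q t)"
    and F_normal_form: "s \<in> S \<Longrightarrow> F (t, s) = normal_form (A t) (P t) (Q t) (Y t) (Z t) (L t * s + c t)"
proof -
  have *: "X t $ 2 \<noteq> 0 \<or> X t $ 3 \<noteq> 0" using assms by (auto simp: V_def)
  show "form_cond (A t) (P t) (Q t)"
    unfolding A_def P_def Q_def by (rule initial_normal_form(1)[OF *])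
  show "F (t, s) = normal_form (A t) (P t) (Q t) (Y t) (Z t) (L t * s + c t)" if "s \<in> S"
    using F[of t s] that assms initial_normal_form(2)[OF *]
    unfolding A_def P_def Q_def Y_def Z_def L_def c_def by simp
qed

lemma F_vertical:
  assumes "t \<in> V" "s \<in> S"
  shows "F (t, s) = vector [\<gamma> t $ 1 + s * X t $ 1, \<gamma> t $ 2, \<gamma> t $ 3]"
proof -
  have "X t = vector [X t $ 1, 0, 0]" using assms(1) by (simp add: V_def vec_eq_iff forall_3)
  then show ?thesis using F[of t s] assms riem_exp_vertical V_def by (metis (no_types, lifting) mem_Collect_eq)
qed

lemma surf_s_vertical:
  assumes "t \<in> V" "s \<in> S"
  shows "surf_s F (t, s) = vector [X t $ 1, 0, 0]"
  by (rule surf_s_eq[where G = "\<lambda>s. vector [\<gamma> t $ 1 + s * X t $ 1, \<gamma> t $ 2, \<gamma> t $ 3]",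
        OF S(1) assms(2) F_vertical[OF assms(1)]], assumption, rule has_vector_derivative_vector_3)
    (auto intro!: derivative_eq_intros)

lemma normal_form_surface_F:
  assumes "t \<in> T - V" "s \<in> S"
  shows "surf_s F (t, s) = L t *\<^sub>R vector [- tanh (L t * s + c t) / p,
      P t * (1 - (tanh (L t * s + c t))\<^sup>2), Q t * (1 - (tanh (L t * s + c t))\<^sup>2)]"
    and "g (F (t, s)) (surf_t F (t, s)) (surf_s F (t, s)) = L t * (\<epsilon>\<^sup>2 / p\<^sup>2 * (deriv L t * s + deriv c t)
      + \<alpha>\<^sup>2 * exp (- 2 * p * A t) * (P t * deriv Y t + Q t * deriv Z t))"
  by (rule normal_form_surface[OF open_non_vertical assms(1) S(1) assms(2) smooth_normal_form_data(3-7,1,2)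
        form_cond F_normal_form]; assumption)+

text \<open>\<open>g F\<^sub>t F\<^sub>s\<close> is affine in \<open>s\<close> here, so both of its coefficients vanish.\<close>
lemma non_vertical_orthogonality:
  assumes t: "t \<in> T - V"
  shows "deriv L t = 0"
    and "\<epsilon>\<^sup>2 / p\<^sup>2 * deriv c t + \<alpha>\<^sup>2 * exp (- 2 * p * A t) * (P t * deriv Y t + Q t * deriv Z t) = 0"
proof -
  let ?r = "\<alpha>\<^sup>2 * exp (- 2 * p * A t) * (P t * deriv Y t + Q t * deriv Z t)"
  have "\<epsilon>\<^sup>2 / p\<^sup>2 * deriv L t * s + (\<epsilon>\<^sup>2 / p\<^sup>2 * deriv c t + ?r) = 0" if "s \<in> S" for s
  proof -
    have "L t * (\<epsilon>\<^sup>2 / p\<^sup>2 * (deriv L t * s + deriv c t) + ?r) = 0"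
      using orth[of t s] t that unfolding normal_form_surface_F(2)[OF t that] by blast
    then have "\<epsilon>\<^sup>2 / p\<^sup>2 * (deriv L t * s + deriv c t) + ?r = 0"
      using L_nonzero[of t] t unfolding mult_eq_0_iff by blast
    then show ?thesis by (simp only: distrib_left mult.assoc add.assoc)
  qed
  from affine_zero_on_open[OF S this] p eps
  show "deriv L t = 0" "\<epsilon>\<^sup>2 / p\<^sup>2 * deriv c t + ?r = 0" by simp_all
qed

text \<open>At an interior point the vertical formula for \<open>F\<close> holds for all nearby
  \<open>t\<close> and may be differentiated. Orthogonality to \<open>e1\<close> then kills the
  first entry of \<open>surf_t F\<close>, which is affine in \<open>s\<close>.\<close>

lemma vertical_orthogonality:
  assumes t: "t \<in> interior V"
  shows "deriv (\<lambda>t. \<gamma> t $ 1) t = 0" "deriv (\<lambda>t. X t $ 1) t = 0"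
proof -
  have tV: "t \<in> V" and tT: "t \<in> T" using t interior_subset by (auto simp: V_def)
  note d = smooth_on_DERIV[OF smooth_on_vec_nth[OF open_T] tT]
  have X1: "X t $ 1 \<noteq> 0"
    using X_nonzero[OF tT] tV by (simp add: V_def vec_eq_iff forall_3)
  have "deriv (\<lambda>t. X t $ 1) t * s + deriv (\<lambda>t. \<gamma> t $ 1) t = 0" if s: "s \<in> S" for s
  proof -
    have "surf_t F (t, s) = vector [deriv (\<lambda>t. \<gamma> t $ 1) t + s * deriv (\<lambda>t. X t $ 1) t,
        deriv (\<lambda>t. \<gamma> t $ 2) t, deriv (\<lambda>t. \<gamma> t $ 3) t]"
    proof (rule surf_t_eq[OF open_interior t])
      show "F (t, s) = vector [\<gamma> t $ 1 + s * X t $ 1, \<gamma> t $ 2, \<gamma> t $ 3]" if "t \<in> interior V" for t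
        using F_vertical[OF _ s] that interior_subset by blast
    qed (auto intro!: has_vector_derivative_vector_3 derivative_eq_intros d \<gamma> X)
    with orth[OF tT s] surf_s_vertical[OF tV s]
    have "\<epsilon>\<^sup>2 * X t $ 1 * (deriv (\<lambda>t. X t $ 1) t * s + deriv (\<lambda>t. \<gamma> t $ 1) t) = 0"
      by (simp add: sol_metric_eq algebra_simps)
    with X1 eps show ?thesis by simp
  qed
  from affine_zero_on_open[OF S this]
  show "deriv (\<lambda>t. \<gamma> t $ 1) t = 0" "deriv (\<lambda>t. X t $ 1) t = 0" by simp_all
qed

lemma v_square_vertical: "t \<in> V \<Longrightarrow> (v t)\<^sup>2 = (\<epsilon> * X t $ 1)\<^sup>2"
  unfolding v_def speed_square sol_metric_eq by (simp add: V_def power2_eq_square)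

text \<open>Off the frontier a parameter is either non-vertical, where \<open>L\<close> is a
  constant multiple of \<open>v\<close>, or interior to \<open>V\<close>, where \<open>v^2\<close>
  is \<open>(\<epsilon> * X t $ 1)^2\<close>. In both cases the quantity has derivative
  zero.\<close>

lemma deriv_v: "t \<in> T - frontier V \<Longrightarrow> deriv v t = 0"
proof -
  assume t: "t \<in> T - frontier V"
  then consider "t \<in> T - V" | "t \<in> interior V"
    unfolding frontier_def using closure_subset[of V] by blast
  then show ?thesis
  proof cases
    case 1
    have "(L has_real_derivative p * deriv v t / \<epsilon>) (at t)"
      unfolding L_eq[abs_def] using 1 smooth_on_DERIV[OF smooth_v, of t] eps
      by (auto intro!: derivative_eq_intros)
    from DERIV_imp_deriv[OF this] non_vertical_orthogonality(1)[OF 1] p eps show ?thesis by simp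
  next
    case 2
    have "((\<lambda>t. (v t)\<^sup>2) has_real_derivative 2 * v t * deriv v t) (at t)"
      using t smooth_on_DERIV[OF smooth_v, of t] by (auto intro!: derivative_eq_intros)
    moreover have "((\<lambda>t. (\<epsilon> * X t $ 1)\<^sup>2) has_real_derivative 0) (at t)"
      using t smooth_on_DERIV[OF smooth_on_vec_nth[OF open_T X, of 1], of t] vertical_orthogonality(2)[OF 2]
      by (auto intro!: derivative_eq_intros)
    then have "((\<lambda>t. (v t)\<^sup>2) has_real_derivative 0) (at t)"
      by (rule has_field_derivative_transform_within_open[OF _ open_interior 2])
        (use v_square_vertical interior_subset in \<open>metis subsetD\<close>)
    ultimately have "2 * v t * deriv v t = 0" by (rule DERIV_unique)
    with v_pos[of t] t show ?thesis by simp
  qed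
qed

text \<open>\<open>deriv v\<close> is continuous, so the set where it is nonzero is open. If
  nonempty, this set would meet the dense set of parameters off the frontier, where
  \<open>deriv v\<close> vanishes.\<close>

lemma v_constant:
  assumes "t \<in> T" "t' \<in> T"
  shows "v t = v t'"
proof (rule smooth_zero_deriv_const[OF smooth_v[unfolded T] _ assms[unfolded T], folded T])
  fix x assume x: "x \<in> T"
  show "deriv v x = 0"
  proof (rule ccontr)
    assume "deriv v x \<noteq> 0"
    moreover have "open (T \<inter> deriv v -` (- {0}))"
      by (rule continuous_open_preimage[OF smooth_on_imp_continuous_on[OF smooth_on_real_deriv[OF open_T smooth_v]]])
        (auto simp: open_T)
    moreover have "x \<in> closure (T - frontier V)"
      using subset_closure_diff_frontier[OF open_T open_non_vertical] x by blast
    ultimately have "(T \<inter> deriv v -` (- {0})) \<inter> (T - frontier V) \<noteq> {}"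
      using x open_Int_closure_eq_empty[of "T \<inter> deriv v -` (- {0})" "T - frontier V"] by auto
    then show False using deriv_v by blast
  qed
qed

text \<open>Geodesics keep their initial speed; here this is read off the explicit formula of each
  kind of ruling.\<close>

lemma norm_surf_s:
  assumes "t \<in> T" "s \<in> S"
  shows "sol_norm p \<epsilon> \<alpha> (F (t, s)) (surf_s F (t, s)) = v t"
proof -
  have "g (F (t, s)) (surf_s F (t, s)) (surf_s F (t, s)) = (v t)\<^sup>2"
  proof (cases "t \<in> V")
    case True
    then show ?thesis
      unfolding v_square_vertical[OF True] surf_s_vertical[OF True assms(2)] sol_metric_eq
      by (simp add: power2_eq_square)
  next
    case False
    with assms have t: "t \<in> T - V" by simp
    show ?thesis
      unfolding normal_form_surface_F(1)[OF t assms(2)] F_normal_form[OF t assms(2)]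
        metric_normal_form_ss[OF form_cond[OF t]]
      using p eps by (simp add: L_eq power_divide power_mult_distrib)
  qed
  then show ?thesis
    using v_pos[OF assms(1)] by (simp add: sol_norm_def)
qed

text \<open>For one inclusion a single \<open>s\<close> suffices: off \<open>V\<close> the last two
  entries of \<open>surf_s F\<close> are nonzero multiples of \<open>P t\<close> and
  \<open>Q t\<close>, and \<open>form_cond\<close> forbids that both vanish.\<close>

lemma vertical_rulings_eq: "vertical_rulings p T S F = V"
proof (intro equalityI subsetI)
  fix t assume t: "t \<in> V"
  have "surf_s F (t, s) = X t $ 1 *\<^sub>R sol_frame p 1 (F (t, s))" if "s \<in> S" for s
    by (simp add: surf_s_vertical[OF t that] sol_frame_1 vec_eq_iff forall_3 axis_def)
  then have "surf_s F (t, s) \<in> span {sol_frame p 1 (F (t, s))}" if "s \<in> S" for s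
    using that by (simp add: span_scale span_base)
  with t show "t \<in> vertical_rulings p T S F" by (simp add: vertical_rulings_def V_def)
next
  fix t assume t: "t \<in> vertical_rulings p T S F"
  then have tT: "t \<in> T" by (simp add: vertical_rulings_def)
  obtain s where s: "s \<in> S" using S by blast
  show "t \<in> V"
  proof (rule ccontr)
    assume "t \<notin> V"
    with tT have tV: "t \<in> T - V" by simp
    from t s obtain k where k: "surf_s F (t, s) = k *\<^sub>R axis 1 1"
      by (auto simp: vertical_rulings_def span_singleton sol_frame_1)
    let ?h = "1 - (tanh (L t * s + c t))\<^sup>2"
    have "?h \<noteq> 0" using cosh_square_tanh[of "L t * s + c t"] by auto
    moreover have "L t * (P t * ?h) = 0" "L t * (Q t * ?h) = 0"
      using arg_cong[OF k[unfolded normal_form_surface_F(1)[OF tV s]], of "\<lambda>u. u $ 2"]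
        arg_cong[OF k[unfolded normal_form_surface_F(1)[OF tV s]], of "\<lambda>u. u $ 3"]
      by (simp_all add: axis_def)
    ultimately have "P t = 0" "Q t = 0" using L_nonzero[OF tT] by simp_all
    with form_cond_metric[OF form_cond[OF tV]] eps p show False by simp
  qed
qed

section \<open>Recovering the two forms\<close>

lemma vertical_form2:
  assumes "einterval a b \<subseteq> V" "a < b" "t0 \<in> T"
  obtains k where "k = v t0 \<or> k = - v t0" "sol_form2 \<epsilon> (einterval a b) ((*) k ` S) (\<lambda>(t, s). F (t, s / k))"
proof -
  let ?I = "einterval a b"
  have I: "?I \<subseteq> interior V" using assms(1) by (simp add: interior_maximal)
  have IT: "?I \<subseteq> T" using assms(1) by (auto simp: V_def)
  obtain t1 where t1: "t1 \<in> ?I" using einterval_nonempty[OF assms(2)] by blast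
  note sm = smooth_on_vec_nth[OF open_einterval smooth_on_subset[OF \<gamma> IT]]
    smooth_on_vec_nth[OF open_einterval smooth_on_subset[OF X IT]]
  define R where "R = \<gamma> t1 $ 1"
  \<comment> \<open>The signed speed. It is negative when \<open>X\<close> points against
    \<open>e1\<close>, and replacing \<open>s\<close> by \<open>s / k\<close> gives the first
    coordinate the slope \<open>1 / \<epsilon>\<close>.\<close>
  define k where "k = \<epsilon> * X t1 $ 1"
  have \<gamma>1: "\<gamma> t $ 1 = R" if "t \<in> ?I" for t
    unfolding R_def using vertical_orthogonality(1) I
    by (intro smooth_zero_deriv_const[OF sm(1) _ that t1]) blast
  have X1: "X t $ 1 = k / \<epsilon>" if "t \<in> ?I" for t
    using smooth_zero_deriv_const[OF sm(2) _ that t1] vertical_orthogonality(2) I eps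
    by (simp add: k_def subset_iff)
  have kv: "k\<^sup>2 = (v t0)\<^sup>2"
    using v_square_vertical[of t1] v_constant[of t1 t0] subsetD[OF assms(1) t1] subsetD[OF IT t1] assms(3)
    by (simp add: k_def)
  then have k: "k = v t0 \<or> k = - v t0" by (simp add: power2_eq_iff)
  with v_pos[OF assms(3)] have "k \<noteq> 0" by auto
  have "sol_form2 \<epsilon> ?I ((*) k ` S) (\<lambda>(t, s). F (t, s / k))"
    unfolding sol_form2_def
  proof (intro exI conjI ballI)
    fix t s assume t: "t \<in> ?I" and "s \<in> (*) k ` S"
    then obtain s' where s': "s' \<in> S" "s = k * s'" by blast
    show "(case (t, s) of (t, s) \<Rightarrow> F (t, s / k)) = vector [R + s / \<epsilon>, \<gamma> t $ 2, \<gamma> t $ 3]"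
      using F_vertical[of t s'] t assms(1) s' \<open>k \<noteq> 0\<close> \<gamma>1[OF t] X1[OF t] by (auto simp: mult.commute)
  qed (rule sm)+
  with k that show ?thesis by blast
qed

text \<open>The free functions are extracted from the normal form data: \<open>\<theta>\<close> from
  the angle of the horizontal direction, and \<open>b1\<close> from the component of the derivative
  of \<open>(Y, Z)\<close> that orthogonality leaves undetermined.\<close>

lemma non_vertical_form1:
  assumes I: "einterval a b \<subseteq> T - V" and "a < b" and t0: "t0 \<in> T"
  shows "sol_form1 p \<epsilon> \<alpha> (einterval a b) ((*) (v t0) ` S) (\<lambda>(t, s). F (t, s / v t0))"
proof -
  let ?I = "einterval a b"
  obtain t1 where t1: "t1 \<in> ?I" using einterval_nonempty[OF assms(2)] by blast
  note sm = smooth_normal_form_data[THEN smooth_on_subset, OF I]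
  \<comment> \<open>\<open>k\<close> has the sign of \<open>p\<close>. By \<open>form_cond\<close>
    the vector \<open>(P, Q)\<close> divided by \<open>k * exp (p * A)\<close> has length 1, and its
    angle is what the form calls \<open>A1 + \<theta>\<close>.\<close>
  define k where "k = \<epsilon> / (p * \<alpha>)"
  have k: "k \<noteq> 0" using eps al p by (simp add: k_def)
  define e where "e t = exp (p * A t)" for t
  have e: "smooth_on ?I e"
    unfolding e_def[abs_def] by (intro smooth_on_exp smooth_on_mult smooth_on_const sm open_einterval)
  have e0: "e t \<noteq> 0" for t by (simp add: e_def)
  have ee: "exp (2 * p * A t) = (e t)\<^sup>2" for t by (simp add: e_def power2_eq_square flip: exp_add)
  have sm_dir: "smooth_on ?I (\<lambda>t. P t / (k * e t))" "smooth_on ?I (\<lambda>t. Q t / (k * e t))"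
    using k e0 by (intro smooth_on_divide smooth_on_mult smooth_on_const sm e open_einterval; simp)+
  have dir: "(P t / (k * e t))\<^sup>2 + (Q t / (k * e t))\<^sup>2 = 1" if "t \<in> ?I" for t
    using form_cond[of t] that I k e0[of t]
    by (auto simp: form_cond_def ee k_def[symmetric] power_divide power_mult_distrib simp flip: add_divide_distrib)
  obtain \<phi> where \<phi>: "smooth_on ?I \<phi>"
    and "\<And>t. t \<in> ?I \<Longrightarrow> P t / (k * e t) = cos (\<phi> t) \<and> Q t / (k * e t) = sin (\<phi> t)"
    using smooth_angle[OF sm_dir dir t1] by blast
  then have PQ: "P t = k * e t * cos (\<phi> t)" "Q t = k * e t * sin (\<phi> t)" if "t \<in> ?I" for t
    using that k e0[of t] by (metis mult_eq_0_iff nonzero_mult_div_cancel_left times_divide_eq_right)+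
  define b1 where "b1 t = \<alpha> * (sin (\<phi> t) * deriv Y t - cos (\<phi> t) * deriv Z t) / e t" for t
  define \<theta> where "\<theta> t = \<phi> t - A t" for t
  have sm_b1: "smooth_on ?I b1" "smooth_on ?I \<theta>"
    unfolding b1_def[abs_def] \<theta>_def[abs_def]
    by (intro smooth_on_divide smooth_on_mult smooth_on_diff smooth_on_sin smooth_on_cos smooth_on_const
        smooth_on_real_deriv sm e e0 \<phi> open_einterval)+
  have dYZ: "deriv Y t = e t * (- k * deriv c t * cos (\<phi> t) + b1 t / \<alpha> * sin (\<phi> t))"
    "deriv Z t = - (e t * (k * deriv c t * sin (\<phi> t) + b1 t / \<alpha> * cos (\<phi> t)))" if t: "t \<in> ?I" for t
  proof -
    let ?C = "cos (\<phi> t)" and ?S = "sin (\<phi> t)"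
    have n: "exp (- 2 * p * A t) * (e t)\<^sup>2 = 1" unfolding ee[symmetric] by (simp flip: exp_add)
    have ak: "\<epsilon>\<^sup>2 / p\<^sup>2 = \<alpha>\<^sup>2 * k\<^sup>2" using al by (simp add: k_def power_divide power_mult_distrib)
    have "\<alpha>\<^sup>2 * k\<^sup>2 * deriv c t
        + \<alpha>\<^sup>2 * exp (- 2 * p * A t) * (k * e t * ?C * deriv Y t + k * e t * ?S * deriv Z t) = 0"
      using non_vertical_orthogonality(2)[of t] t I unfolding ak PQ[OF t] by blast
    with n have "\<alpha>\<^sup>2 * k * (e t * (k * deriv c t * e t + ?C * deriv Y t + ?S * deriv Z t)) = 0"
      by algebra
    then have "k * deriv c t * e t + ?C * deriv Y t + ?S * deriv Z t = 0"
      using k al e0[of t] by simp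
    \<comment> \<open>Orthogonality gives the component along \<open>(cos, sin)\<close> of the
      angle, and \<open>b\<close> below gives the component across it; a rotation then recovers both
      derivatives.\<close>
    then have r: "?C * deriv Y t + ?S * deriv Z t = - k * deriv c t * e t"
      by linarith
    have b: "e t * (b1 t / \<alpha>) = ?S * deriv Y t - ?C * deriv Z t"
      using al e0[of t] by (simp add: b1_def)
    show "deriv Y t = e t * (- k * deriv c t * ?C + b1 t / \<alpha> * ?S)"
      "deriv Z t = - (e t * (k * deriv c t * ?S + b1 t / \<alpha> * ?C))"
      using r b sin_cos_squared_add2[of "\<phi> t"] by algebra+
  qed
  have sm_int: "smooth_on ?I (\<lambda>t. e t * (- k * deriv c t * cos (\<phi> t) + b1 t / \<alpha> * sin (\<phi> t)))"
    "smooth_on ?I (\<lambda>t. e t * (k * deriv c t * sin (\<phi> t) + b1 t / \<alpha> * cos (\<phi> t)))"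
    using al by (intro smooth_on_divide smooth_on_mult smooth_on_add smooth_on_sin smooth_on_cos smooth_on_const
        smooth_on_real_deriv sm e e0 \<phi> sm_b1 open_einterval; simp)+
  have Y: "Y t = Y t1 + (LBINT u=t1..t. e u * (- k * deriv c u * cos (\<phi> u) + b1 u / \<alpha> * sin (\<phi> u)))"
    if "t \<in> ?I" for t
    by (rule smooth_eq_integral[OF _ sm_int(1) t1 that])
      (use smooth_on_DERIV[OF sm(6)] in \<open>simp add: dYZ(1)\<close>)
  have Z: "Z t = Z t1 - (LBINT u=t1..t. e u * (k * deriv c u * sin (\<phi> u) + b1 u / \<alpha> * cos (\<phi> u)))"
    if "t \<in> ?I" for t
  proof -
    have "- Z t = - Z t1 + (LBINT u=t1..t. e u * (k * deriv c u * sin (\<phi> u) + b1 u / \<alpha> * cos (\<phi> u)))"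
      by (rule smooth_eq_integral[OF _ sm_int(2) t1 that])
        (use DERIV_minus[OF smooth_on_DERIV[OF sm(7)]] in \<open>simp add: dYZ(2)\<close>)
    then show ?thesis by linarith
  qed
  show ?thesis
    unfolding sol_form1_def
  proof (intro exI bexI conjI ballI)
    show "smooth_on ?I c" "smooth_on ?I \<theta>" "smooth_on ?I A" "smooth_on ?I b1" "t1 \<in> ?I"
      by (fact sm sm_b1 t1)+
    fix t s assume t: "t \<in> ?I" and "s \<in> (*) (v t0) ` S"
    then obtain s' where s': "s' \<in> S" "s = v t0 * s'" by blast
    have "t \<in> T" using t I by blast
    \<comment> \<open>The rate \<open>L t\<close> is \<open>p * v t0 / \<epsilon>\<close> for every
      \<open>t\<close>, so measuring \<open>s\<close> in arc length turns it into
      \<open>p / \<epsilon>\<close>.\<close>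
    have Ls: "L t * s' + c t = p / \<epsilon> * s + c t"
      unfolding L_eq v_constant[OF \<open>t \<in> T\<close> t0] s'(2) by simp
    have "F (t, s / v t0) = normal_form (A t) (P t) (Q t) (Y t) (Z t) (p / \<epsilon> * s + c t)"
      using F_normal_form[of t s'] t I s' v_pos[OF t0] Ls by auto
    then show "(case (t, s) of (t, s) \<Rightarrow> F (t, s / v t0)) = vector
          [A t - 1 / p * ln (cosh (p / \<epsilon> * s + c t)),
           Y t1 + (LBINT u=t1..t. exp (p * A u) *
                   (- (\<epsilon> / (p * \<alpha>)) * deriv c u * cos (A u + \<theta> u)
                    + b1 u / \<alpha> * sin (A u + \<theta> u)))
              + \<epsilon> / (p * \<alpha>) * exp (p * A t) * cos (A t + \<theta> t) * tanh (p / \<epsilon> * s + c t),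
           Z t1 - (LBINT u=t1..t. exp (p * A u) *
                   (\<epsilon> / (p * \<alpha>) * deriv c u * sin (A u + \<theta> u)
                    + b1 u / \<alpha> * cos (A u + \<theta> u)))
              + \<epsilon> / (p * \<alpha>) * exp (p * A t) * sin (A t + \<theta> t) * tanh (p / \<epsilon> * s + c t)]"
      using Y[OF t] Z[OF t] PQ[OF t]
      by (simp add: normal_form_def \<theta>_def k_def[symmetric] e_def[symmetric])
  qed
qed

end

text \<open>That the functions in the forms are arbitrary is expressed by the second conjunct. In
  the first one, passing to \<open>s / k\<close> normalises the rulings to unit speed, and the sign
  of \<open>k\<close> allows for vertical rulings that run against \<open>e1\<close>.\<close>

theorem theorem3p2:
  fixes p \<epsilon> \<alpha> :: real and t1 t2 s1 s2 :: ereal and T S :: "real set"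
    and F :: "real \<times> real \<Rightarrow> real^3"
  assumes "\<epsilon> > 0" and "\<alpha> > 0" and "p \<noteq> 0"
    and "t1 < t2" and "s1 < s2"
    and "T = einterval t1 t2" and "S = einterval s1 s2"
  shows
    "(orthogonal_ruled_surface (sol_metric p \<epsilon> \<alpha>) T S F \<longrightarrow>
        (\<exists>c>0. (\<forall>t\<in>T. \<forall>s\<in>S. sol_norm p \<epsilon> \<alpha> (F (t, s)) (surf_s F (t, s)) = c) \<and>
          T \<subseteq> closure (T - frontier (vertical_rulings p T S F)) \<and>
          (\<forall>a b. a < b \<and> einterval a b \<subseteq> T - frontier (vertical_rulings p T S F) \<longrightarrow>
             (\<exists>k\<in>{c, -c}.
                sol_form1 p \<epsilon> \<alpha> (einterval a b) ((*) k ` S) (\<lambda>(t, s). F (t, s / k)) \<or>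
                sol_form2 \<epsilon> (einterval a b) ((*) k ` S) (\<lambda>(t, s). F (t, s / k)))))) \<and>
     (sol_form1 p \<epsilon> \<alpha> T S F \<or> sol_form2 \<epsilon> T S F \<longrightarrow>
        orthogonal_ruled_surface (sol_metric p \<epsilon> \<alpha>) T S F)"
proof (intro conjI impI)
  interpret sol_params p \<epsilon> \<alpha> by unfold_locales (use assms in auto)
  show "orthogonal_ruled_surface (sol_metric p \<epsilon> \<alpha>) T S F"
    if "sol_form1 p \<epsilon> \<alpha> T S F \<or> sol_form2 \<epsilon> T S F"
    using that sol_form1_orthogonal[OF assms(6)] sol_form2_orthogonal assms(6,7) by auto
  assume "orthogonal_ruled_surface (sol_metric p \<epsilon> \<alpha>) T S F"
  then obtain \<gamma> X where "smooth_on T \<gamma>" "smooth_on T X" "\<forall>t\<in>T. X t \<noteq> 0"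
    "\<forall>t\<in>T. \<forall>s\<in>S. F (t, s) = riem_exp (sol_metric p \<epsilon> \<alpha>) (\<gamma> t) (s *\<^sub>R X t)"
    "\<forall>t\<in>T. \<forall>s\<in>S. sol_metric p \<epsilon> \<alpha> (F (t, s)) (surf_t F (t, s)) (surf_s F (t, s)) = 0"
    unfolding orthogonal_ruled_surface_def ruled_surface_def by blast
  then interpret orthogonal_ruling p \<epsilon> \<alpha> t1 t2 T S F \<gamma> X
    using einterval_nonempty[OF assms(4)] einterval_nonempty[OF assms(5)]
    by unfold_locales (auto simp: assms(6,7))
  obtain t0 where t0: "t0 \<in> T" using T_nonempty by blast
  show "\<exists>c>0. (\<forall>t\<in>T. \<forall>s\<in>S. sol_norm p \<epsilon> \<alpha> (F (t, s)) (surf_s F (t, s)) = c) \<and>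
          T \<subseteq> closure (T - frontier (vertical_rulings p T S F)) \<and>
          (\<forall>a b. a < b \<and> einterval a b \<subseteq> T - frontier (vertical_rulings p T S F) \<longrightarrow>
             (\<exists>k\<in>{c, -c}.
                sol_form1 p \<epsilon> \<alpha> (einterval a b) ((*) k ` S) (\<lambda>(t, s). F (t, s / k)) \<or>
                sol_form2 \<epsilon> (einterval a b) ((*) k ` S) (\<lambda>(t, s). F (t, s / k))))"
    unfolding vertical_rulings_eq
  proof (intro exI[of _ "v t0"] conjI ballI allI impI)
    show "v t0 > 0" by (rule v_pos[OF t0])
    show "sol_norm p \<epsilon> \<alpha> (F (t, s)) (surf_s F (t, s)) = v t0" if "t \<in> T" "s \<in> S" for t s
      using norm_surf_s[OF that] v_constant[OF that(1) t0] by simp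
    show "T \<subseteq> closure (T - frontier V)"
      by (rule subset_closure_diff_frontier[OF open_T open_non_vertical])
    fix a b :: ereal assume ab: "a < b \<and> einterval a b \<subseteq> T - frontier V"
    \<comment> \<open>An interval is connected, so one that avoids the frontier of \<open>V\<close>
      lies on one side of it.\<close>
    then have "einterval a b \<inter> V = {} \<or> einterval a b \<subseteq> V"
      using connected_Int_frontier[OF convex_connected[OF convex_einterval], of a b V] by blast
    then show "\<exists>k\<in>{v t0, - v t0}.
        sol_form1 p \<epsilon> \<alpha> (einterval a b) ((*) k ` S) (\<lambda>(t, s). F (t, s / k)) \<or>
        sol_form2 \<epsilon> (einterval a b) ((*) k ` S) (\<lambda>(t, s). F (t, s / k))"
    proof
      assume "einterval a b \<inter> V = {}"
      with ab have "einterval a b \<subseteq> T - V" by blast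
      then show ?thesis using non_vertical_form1[OF _ _ t0] ab by blast
    next
      assume "einterval a b \<subseteq> V"
      then show ?thesis using vertical_form2[OF _ _ t0] ab by (metis insertCI)
    qed
  qed
qed

end
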